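(* Let $T$ be a restricted Lie color triple system over a field $\mathbf{K}$ of characteristic $p>3$, and let $(V,\theta)$ be a restricted representation of $T$. Equip $T\oplus V$ (graded by $(T\oplus V)_\gamma=T_\gamma\oplus V_\gamma$) with the trilinear operation given on homogeneous elements $(x,a),(y,b),(z,c)$, of degrees $\bar x,\bar y,\bar z$, by $$[(x,a),(y,b),(z,c)]_V=\bigl([x,y,z],\ \varepsilon(\bar x,\bar y+\bar z)\theta(y,z)(a)-\varepsilon(\bar y,\bar z)\theta(x,z)(b)+D(x,y)(c)\bigr).$$ Then, for any choice of bases $(x_{i,\gamma},v_{i,\gamma})_i$ of $(T\oplus V)_\gamma$ for all $\gamma\in G_+$, there exists a $p$-map on the Lie color triple system $T\oplus V$ such that $$(x_{i,\gamma},v_{i,\gamma})^{[p]}=\bigl(x_{i,\gamma}^{[p]},\ \theta(x_{i,\gamma},x_{i,\gamma})^{\frac{p-1}{2}}(v_{i,\gamma})\bigr)$$ for all $\gamma\in G_+$ and all $i$.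
   Context: $(G,+)$ is an abelian group and $\varepsilon:G\times G\to\mathbf{K}^*$ is a bicharacter: $\varepsilon(\alpha+\beta,\gamma)=\varepsilon(\alpha,\gamma)\varepsilon(\beta,\gamma)$, $\varepsilon(\alpha,\beta+\gamma)=\varepsilon(\alpha,\beta)\varepsilon(\alpha,\gamma)$, $\varepsilon(\alpha,\beta)\varepsilon(\beta,\alpha)=1$. $G_+=\{\gamma:\varepsilon(\gamma,\gamma)=1\}$. $\mathcal H(V)$ denotes homogeneous elements, $\bar x$ the degree of $x$. Lie color triple system: $G$-graded space $T$ with trilinear $[\cdot,\cdot,\cdot]$ such that $[T_i,T_j,T_k]\subset T_{i+j+k}$ and for homogeneous elements: $[x,y,z]=-\varepsilon(\bar x,\bar y)[y,x,z]$; $\varepsilon(\bar z,\bar x)[x,y,z]+\varepsilon(\bar x,\bar y)[y,z,x]+\varepsilon(\bar y,\bar z)[z,x,y]=0$; $[u,v,[x,y,z]]=[[u,v,x],y,z]+\varepsilon(\bar u+\bar v,\bar x)[x,[u,v,y],z]+\varepsilon(\bar u+\bar v,\bar x+\bar y)[x,y,[u,v,z]]$. For odd $n\ge 3$, $(x_1,\dots,x_n)=[[\cdots[[x_1,x_2,x_3],x_4,x_5],\cdots],x_{n-1},x_n]$. $T$ is restricted if equipped with maps $(\cdot)^{[p]}:T_\gamma\to T_{p\gamma}$, $\gamma\in G_+$ (a $p$-map), with: $(\alpha x)^{[p]}=\alpha^px^{[p]}$ for $\alpha\in\mathbf{K}$, $x\in T_\gamma$; $(x+y)^{[p]}=x^{[p]}+y^{[p]}+\sum_{i=1}^{p-1}s_i(x,y)$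 for $x,y\in T_\gamma$, where $i s_i(x,y)$ is the coefficient of $Z^{i-1}$ in $(x,Zx+y,\dots,Zx+y)$ ($Zx+y$ occurring $p-1$ times); $[x,y^{[p]},z]=(x,y,\dots,y,z)$ ($p$ copies of $y$) for $y\in T_\gamma$, $x,z\in T$. A representation of $T$ is a pair $(V,\theta)$ with $V$ a $G$-graded vector space and $\theta:T\times T\to\mathrm{End}(V)$ bilinear such that for all homogeneous $x,y,z,t\in T$, with $D(x,y)=\varepsilon(\bar x,\bar y)\theta(y,x)-\theta(x,y)$: (i) $\theta(x,y)(V_\alpha)\subset V_{\alpha+\bar x+\bar y}$; (ii) $\varepsilon(\bar x+\bar y,\bar z+\bar t)\theta(z,t)\theta(x,y)-\varepsilon(\bar x,\bar y)\varepsilon(\bar x+\bar z,\bar t)\theta(y,t)\theta(x,z)-\theta(x,[y,z,t])+\varepsilon(\bar x,\bar y+\bar z)D(y,z)\theta(x,t)=0$; (iii) $\varepsilon(\bar x+\bar y,\bar z+\bar t)\theta(z,t)D(x,y)-D(x,y)\theta(z,t)+\theta([x,y,z],t)+\varepsilon(\bar x+\bar y,\bar z)\theta(z,[x,y,t])=0$. With the bracket $[\cdot,\cdot,\cdot]_V$ of the claim, $T\oplus V$ is a Lie color triple system. If $T$ is restricted, the representation is restricted if $\theta(x^{[p]},y)=\varepsilon(\bar x,\bar y)^{p-1}\theta(x,y)\circ\theta(x,x)^{\frac{p-1}{2}}$ for all $\gamma\in G_+$, $x\in T_\gamma$, $y\in\mathcal H(T)$, and $\theta(x,y^{[p]})=\varepsilon(\bar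 x,\bar y)^{p-1}\theta(y,y)^{\frac{p-1}{2}}\circ\theta(x,y)$ for all $\gamma\in G_+$, $x\in\mathcal H(T)$, $y\in T_\gamma$. *)

theory Defs
  imports
    "HOL-Analysis.Product_Vector"
    "HOL-Computational_Algebra.Polynomial"
begin

section \<open>Bicharacters\<close>

locale bicharacter =
  fixes \<epsilon> :: "'g::ab_group_add \<Rightarrow> 'g \<Rightarrow> 'k::field"
  assumes eps_nonzero: "\<epsilon> \<alpha> \<beta> \<noteq> 0"
    and eps_add_left: "\<epsilon> (\<alpha> + \<beta>) \<gamma> = \<epsilon> \<alpha> \<gamma> * \<epsilon> \<beta> \<gamma>"
    and eps_add_right: "\<epsilon> \<alpha> (\<beta> + \<gamma>) = \<epsilon> \<alpha> \<beta> * \<epsilon> \<alpha> \<gamma>"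
    and eps_inverse: "\<epsilon> \<alpha> \<beta> * \<epsilon> \<beta> \<alpha> = 1"

definition G_plus :: "('g \<Rightarrow> 'g \<Rightarrow> 'k::field) \<Rightarrow> 'g set" where
  "G_plus \<epsilon> = {\<gamma>. \<epsilon> \<gamma> \<gamma> = 1}"

definition nmult :: "nat \<Rightarrow> 'g::ab_group_add \<Rightarrow> 'g" where
  "nmult n \<gamma> = (\<Sum>i<n. \<gamma>)"

section \<open>Graded vector spaces\<close>

definition is_decomposition :: "('g \<Rightarrow> 't::ab_group_add set) \<Rightarrow> 't \<Rightarrow> ('g \<Rightarrow> 't) \<Rightarrow> bool" where
  "is_decomposition T v c \<longleftrightarrow>
     (\<forall>\<gamma>. c \<gamma> \<in> T \<gamma>) \<and> finite {\<gamma>. c \<gamma> \<noteq> 0} \<and> v = (\<Sum>\<gamma> | c \<gamma> \<noteq> 0. c \<gamma>)"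

text \<open>The ambient type is the internal direct sum of the subspaces \<open>T \<gamma>\<close>.\<close>

locale graded_vector_space = vector_space sc
  for sc :: "'k::field \<Rightarrow> 't::ab_group_add \<Rightarrow> 't" +
  fixes T :: "'g::ab_group_add \<Rightarrow> 't set"
  assumes subspace_grade: "subspace (T \<gamma>)"
    and decomposition: "\<exists>!c. is_decomposition T v c"

definition component :: "('g \<Rightarrow> 't::ab_group_add set) \<Rightarrow> 't \<Rightarrow> 'g \<Rightarrow> 't" where
  "component T v = (THE c. is_decomposition T v c)"

definition direct_sum_grading :: "('g \<Rightarrow> 't set) \<Rightarrow> ('g \<Rightarrow> 'v set) \<Rightarrow> 'g \<Rightarrow> ('t \<times> 'v) set" where
  "direct_sum_grading T V \<gamma> = T \<gamma> \<times> V \<gamma>"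

definition family_basis ::
    "('k::field \<Rightarrow> 't::ab_group_add \<Rightarrow> 't) \<Rightarrow> 't set \<Rightarrow> 'i set \<Rightarrow> ('i \<Rightarrow> 't) \<Rightarrow> bool" where
  "family_basis sc S I e \<longleftrightarrow>
     inj_on e I \<and> \<not> module.dependent sc (e ` I) \<and> module.span sc (e ` I) = S"

text \<open>The degree of a homogeneous element is passed explicitly as an argument, so that an identity
  for homogeneous elements is stated for all degrees and all elements of these degrees. The zero
  element has every degree, but all the identities below hold trivially for it.\<close>

definition trilinear_extension ::
    "('g \<Rightarrow> 't::ab_group_add set) \<Rightarrow> ('g \<Rightarrow> 'g \<Rightarrow> 'g \<Rightarrow> 't \<Rightarrow> 't \<Rightarrow> 't \<Rightarrow> 't) \<Rightarrow> 't \<Rightarrow> 't \<Rightarrow> 't \<Rightarrow> 't" where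
  "trilinear_extension T F u v w =
     (\<Sum>\<alpha> | component T u \<alpha> \<noteq> 0. \<Sum>\<beta> | component T v \<beta> \<noteq> 0. \<Sum>\<gamma> | component T w \<gamma> \<noteq> 0.
        F \<alpha> \<beta> \<gamma> (component T u \<alpha>) (component T v \<beta>) (component T w \<gamma>))"

section \<open>Lie color triple systems\<close>

locale lie_color_triple_system =
  bicharacter \<epsilon> + graded_vector_space sc T
  for \<epsilon> :: "'g::ab_group_add \<Rightarrow> 'g \<Rightarrow> 'k::field"
    and sc :: "'k \<Rightarrow> 't::ab_group_add \<Rightarrow> 't"
    and T :: "'g \<Rightarrow> 't set" +
  fixes br :: "'t \<Rightarrow> 't \<Rightarrow> 't \<Rightarrow> 't"
  assumes linear_1: "Vector_Spaces.linear sc sc (\<lambda>x. br x y z)"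
    and linear_2: "Vector_Spaces.linear sc sc (\<lambda>y. br x y z)"
    and linear_3: "Vector_Spaces.linear sc sc (\<lambda>z. br x y z)"
    and graded: "\<lbrakk>x \<in> T i; y \<in> T j; z \<in> T k\<rbrakk> \<Longrightarrow> br x y z \<in> T (i + j + k)"
    and skew: "\<lbrakk>x \<in> T \<alpha>; y \<in> T \<beta>; z \<in> T \<gamma>\<rbrakk> \<Longrightarrow> br x y z = - sc (\<epsilon> \<alpha> \<beta>) (br y x z)"
    and cyclic: "\<lbrakk>x \<in> T \<alpha>; y \<in> T \<beta>; z \<in> T \<gamma>\<rbrakk> \<Longrightarrow>
      sc (\<epsilon> \<gamma> \<alpha>) (br x y z) + sc (\<epsilon> \<alpha> \<beta>) (br y z x) + sc (\<epsilon> \<beta> \<gamma>) (br z x y) = 0"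
    and derivation: "\<lbrakk>u \<in> T \<mu>; v \<in> T \<nu>; x \<in> T \<alpha>; y \<in> T \<beta>; z \<in> T \<gamma>\<rbrakk> \<Longrightarrow>
      br u v (br x y z) =
        br (br u v x) y z
        + sc (\<epsilon> (\<mu> + \<nu>) \<alpha>) (br x (br u v y) z)
        + sc (\<epsilon> (\<mu> + \<nu>) (\<alpha> + \<beta>)) (br x y (br u v z))"

text \<open>The left-normed product \<open>(x\<^sub>1, \<dots>, x\<^sub>n)\<close>, meaningful only for lists of odd length.\<close>

fun iter_bracket :: "('t \<Rightarrow> 't \<Rightarrow> 't \<Rightarrow> 't) \<Rightarrow> 't list \<Rightarrow> 't" where
  "iter_bracket br (x # y # z # r) = iter_bracket br (br x y z # r)"
| "iter_bracket br [x] = x"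
| "iter_bracket br _ = undefined"

text \<open>The extension of the bracket of \<open>T\<close> to \<open>T \<otimes> K[Z]\<close>, whose elements are the polynomials in
  \<open>Z\<close> with coefficients in \<open>T\<close>.\<close>

definition poly_bracket ::
    "('t::ab_group_add \<Rightarrow> 't \<Rightarrow> 't \<Rightarrow> 't) \<Rightarrow> 't poly \<Rightarrow> 't poly \<Rightarrow> 't poly \<Rightarrow> 't poly" where
  "poly_bracket br f g h =
     (\<Sum>i\<le>degree f. \<Sum>j\<le>degree g. \<Sum>k\<le>degree h.
        monom (br (coeff f i) (coeff g j) (coeff h k)) (i + j + k))"

text \<open>Here \<open>[:y, x:]\<close> is \<open>Z x + y\<close>. The defining relation determines \<open>i s\<^sub>i(x, y)\<close>; for
  \<open>0 < i < p\<close> the integer \<open>i\<close> is invertible in a field of characteristic \<open>p\<close>.\<close>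

definition s_coeff ::
    "nat \<Rightarrow> ('k::field \<Rightarrow> 't::ab_group_add \<Rightarrow> 't) \<Rightarrow> ('t \<Rightarrow> 't \<Rightarrow> 't \<Rightarrow> 't) \<Rightarrow> nat \<Rightarrow> 't \<Rightarrow> 't \<Rightarrow> 't" where
  "s_coeff p sc br i x y =
     sc (1 / of_nat i)
       (coeff (iter_bracket (poly_bracket br) ([:x:] # replicate (p - 1) [:y, x:])) (i - 1))"

text \<open>\<open>pm \<gamma>\<close> is the map \<open>T \<gamma> \<rightarrow> T (p \<gamma>)\<close>; its values for \<open>\<gamma>\<close> outside \<open>G_plus \<epsilon>\<close> or off \<open>T \<gamma>\<close> are
  irrelevant.\<close>

locale restricted_lie_color_triple_system =
  lie_color_triple_system \<epsilon> sc T br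
  for p :: nat
    and \<epsilon> :: "'g::ab_group_add \<Rightarrow> 'g \<Rightarrow> 'k::field"
    and sc :: "'k \<Rightarrow> 't::ab_group_add \<Rightarrow> 't"
    and T :: "'g \<Rightarrow> 't set"
    and br :: "'t \<Rightarrow> 't \<Rightarrow> 't \<Rightarrow> 't" +
  fixes pm :: "'g \<Rightarrow> 't \<Rightarrow> 't"
  assumes p_map_degree: "\<lbrakk>\<gamma> \<in> G_plus \<epsilon>; x \<in> T \<gamma>\<rbrakk> \<Longrightarrow> pm \<gamma> x \<in> T (nmult p \<gamma>)"
    and p_map_scale: "\<lbrakk>\<gamma> \<in> G_plus \<epsilon>; x \<in> T \<gamma>\<rbrakk> \<Longrightarrow> pm \<gamma> (sc a x) = sc (a ^ p) (pm \<gamma> x)"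
    and p_map_add: "\<lbrakk>\<gamma> \<in> G_plus \<epsilon>; x \<in> T \<gamma>; y \<in> T \<gamma>\<rbrakk> \<Longrightarrow>
      pm \<gamma> (x + y) = pm \<gamma> x + pm \<gamma> y + (\<Sum>i = 1..p - 1. s_coeff p sc br i x y)"
    and p_map_bracket: "\<lbrakk>\<gamma> \<in> G_plus \<epsilon>; y \<in> T \<gamma>\<rbrakk> \<Longrightarrow>
      br x (pm \<gamma> y) z = iter_bracket br (x # replicate p y @ [z])"

section \<open>Representations\<close>

definition D_op ::
    "('g \<Rightarrow> 'g \<Rightarrow> 'k::field) \<Rightarrow> ('k \<Rightarrow> 'v::ab_group_add \<Rightarrow> 'v) \<Rightarrow> ('t \<Rightarrow> 't \<Rightarrow> 'v \<Rightarrow> 'v) \<Rightarrow>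
      'g \<Rightarrow> 'g \<Rightarrow> 't \<Rightarrow> 't \<Rightarrow> 'v \<Rightarrow> 'v" where
  "D_op \<epsilon> sc \<theta> \<alpha> \<beta> x y a = sc (\<epsilon> \<alpha> \<beta>) (\<theta> y x a) - \<theta> x y a"

text \<open>In \<open>rep_2\<close> and \<open>rep_3\<close> the letters \<open>\<alpha>, \<beta>, \<gamma>, \<delta>\<close> are the degrees of \<open>x, y, z, t\<close>; the
  operator identities are evaluated at an arbitrary vector \<open>a\<close>.\<close>

locale color_representation =
  lie_color_triple_system \<epsilon> scaleT T br + V: graded_vector_space scaleV V
  for \<epsilon> :: "'g::ab_group_add \<Rightarrow> 'g \<Rightarrow> 'k::field"
    and scaleT :: "'k \<Rightarrow> 't::ab_group_add \<Rightarrow> 't"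
    and T :: "'g \<Rightarrow> 't set"
    and br :: "'t \<Rightarrow> 't \<Rightarrow> 't \<Rightarrow> 't"
    and scaleV :: "'k \<Rightarrow> 'v::ab_group_add \<Rightarrow> 'v"
    and V :: "'g \<Rightarrow> 'v set" +
  fixes \<theta> :: "'t \<Rightarrow> 't \<Rightarrow> 'v \<Rightarrow> 'v"
  assumes theta_linear_1: "Vector_Spaces.linear scaleT scaleV (\<lambda>x. \<theta> x y a)"
    and theta_linear_2: "Vector_Spaces.linear scaleT scaleV (\<lambda>y. \<theta> x y a)"
    and theta_End: "Vector_Spaces.linear scaleV scaleV (\<theta> x y)"
    and rep_1: "\<lbrakk>x \<in> T \<alpha>; y \<in> T \<beta>; a \<in> V \<mu>\<rbrakk> \<Longrightarrow> \<theta> x y a \<in> V (\<mu> + \<alpha> + \<beta>)"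
    and rep_2: "\<lbrakk>x \<in> T \<alpha>; y \<in> T \<beta>; z \<in> T \<gamma>; t \<in> T \<delta>\<rbrakk> \<Longrightarrow>
      scaleV (\<epsilon> (\<alpha> + \<beta>) (\<gamma> + \<delta>)) (\<theta> z t (\<theta> x y a))
      - scaleV (\<epsilon> \<alpha> \<beta> * \<epsilon> (\<alpha> + \<gamma>) \<delta>) (\<theta> y t (\<theta> x z a))
      - \<theta> x (br y z t) a
      + scaleV (\<epsilon> \<alpha> (\<beta> + \<gamma>)) (D_op \<epsilon> scaleV \<theta> \<beta> \<gamma> y z (\<theta> x t a)) = 0"
    and rep_3: "\<lbrakk>x \<in> T \<alpha>; y \<in> T \<beta>; z \<in> T \<gamma>; t \<in> T \<delta>\<rbrakk> \<Longrightarrow>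
      scaleV (\<epsilon> (\<alpha> + \<beta>) (\<gamma> + \<delta>)) (\<theta> z t (D_op \<epsilon> scaleV \<theta> \<alpha> \<beta> x y a))
      - D_op \<epsilon> scaleV \<theta> \<alpha> \<beta> x y (\<theta> z t a)
      + \<theta> (br x y z) t a
      + scaleV (\<epsilon> (\<alpha> + \<beta>) \<gamma>) (\<theta> z (br x y t) a) = 0"

locale restricted_color_representation =
  restricted_lie_color_triple_system p \<epsilon> scaleT T br pm +
  color_representation \<epsilon> scaleT T br scaleV V \<theta>
  for p :: nat
    and \<epsilon> :: "'g::ab_group_add \<Rightarrow> 'g \<Rightarrow> 'k::field"
    and scaleT :: "'k \<Rightarrow> 't::ab_group_add \<Rightarrow> 't"
    and T :: "'g \<Rightarrow> 't set"
    and br :: "'t \<Rightarrow> 't \<Rightarrow> 't \<Rightarrow> 't"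
    and pm :: "'g \<Rightarrow> 't \<Rightarrow> 't"
    and scaleV :: "'k \<Rightarrow> 'v::ab_group_add \<Rightarrow> 'v"
    and V :: "'g \<Rightarrow> 'v set"
    and \<theta> :: "'t \<Rightarrow> 't \<Rightarrow> 'v \<Rightarrow> 'v" +
  assumes restricted_1: "\<lbrakk>\<gamma> \<in> G_plus \<epsilon>; x \<in> T \<gamma>; y \<in> T \<beta>\<rbrakk> \<Longrightarrow>
      \<theta> (pm \<gamma> x) y a = scaleV (\<epsilon> \<gamma> \<beta> ^ (p - 1)) (\<theta> x y ((\<theta> x x ^^ ((p - 1) div 2)) a))"
    and restricted_2: "\<lbrakk>\<gamma> \<in> G_plus \<epsilon>; x \<in> T \<alpha>; y \<in> T \<gamma>\<rbrakk> \<Longrightarrow>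
      \<theta> x (pm \<gamma> y) a = scaleV (\<epsilon> \<alpha> \<gamma> ^ (p - 1)) ((\<theta> y y ^^ ((p - 1) div 2)) (\<theta> x y a))"

section \<open>The semidirect product bracket on \<open>T \<oplus> V\<close>\<close>

fun semidirect_formula ::
    "('g::ab_group_add \<Rightarrow> 'g \<Rightarrow> 'k::field) \<Rightarrow> ('t \<Rightarrow> 't \<Rightarrow> 't \<Rightarrow> 't) \<Rightarrow>
     ('k \<Rightarrow> 'v::ab_group_add \<Rightarrow> 'v) \<Rightarrow> ('t \<Rightarrow> 't \<Rightarrow> 'v \<Rightarrow> 'v) \<Rightarrow>
     'g \<Rightarrow> 'g \<Rightarrow> 'g \<Rightarrow> 't \<times> 'v \<Rightarrow> 't \<times> 'v \<Rightarrow> 't \<times> 'v \<Rightarrow> 't \<times> 'v" where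
  "semidirect_formula \<epsilon> br scaleV \<theta> \<alpha> \<beta> \<gamma> (x, a) (y, b) (z, c) =
     (br x y z,
      scaleV (\<epsilon> \<alpha> (\<beta> + \<gamma>)) (\<theta> y z a) - scaleV (\<epsilon> \<beta> \<gamma>) (\<theta> x z b)
        + D_op \<epsilon> scaleV \<theta> \<alpha> \<beta> x y c)"

definition semidirect_bracket ::
    "('g::ab_group_add \<Rightarrow> 'g \<Rightarrow> 'k::field) \<Rightarrow> ('g \<Rightarrow> 't::ab_group_add set) \<Rightarrow> ('t \<Rightarrow> 't \<Rightarrow> 't \<Rightarrow> 't) \<Rightarrow>
     ('k \<Rightarrow> 'v::ab_group_add \<Rightarrow> 'v) \<Rightarrow> ('g \<Rightarrow> 'v set) \<Rightarrow> ('t \<Rightarrow> 't \<Rightarrow> 'v \<Rightarrow> 'v) \<Rightarrow>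
     't \<times> 'v \<Rightarrow> 't \<times> 'v \<Rightarrow> 't \<times> 'v \<Rightarrow> 't \<times> 'v" where
  "semidirect_bracket \<epsilon> T br scaleV V \<theta> =
     trilinear_extension (direct_sum_grading T V) (semidirect_formula \<epsilon> br scaleV \<theta>)"

lemma (in graded_vector_space) decomposition_homogeneous:
  assumes "x \<in> T \<alpha>"
  shows "is_decomposition T x (\<lambda>\<delta>. if \<delta> = \<alpha> then x else 0)"
proof -
  have "{\<gamma>. (if \<gamma> = \<alpha> then x else 0) \<noteq> 0} = (if x = 0 then {} else {\<alpha>})" by auto
  then show ?thesis
    using assms subspace_0[OF subspace_grade] unfolding is_decomposition_def by auto
qed

lemma direct_sum_graded:
  assumes "graded_vector_space sT T" "graded_vector_space sV V"
  shows "graded_vector_space (module_prod.scale sT sV) (direct_sum_grading T V)"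
proof -
  interpret T: graded_vector_space sT T by fact
  interpret V: graded_vector_space sV V by fact
  interpret P: vector_space_prod sT sV by unfold_locales
  have eq: "is_decomposition (direct_sum_grading T V) u c \<longleftrightarrow>
      is_decomposition T (fst u) (fst \<circ> c) \<and> is_decomposition V (snd u) (snd \<circ> c)" for u c
  proof -
    let ?S = "{\<gamma>. c \<gamma> \<noteq> 0}" and ?A = "{\<gamma>. fst (c \<gamma>) \<noteq> 0}" and ?B = "{\<gamma>. snd (c \<gamma>) \<noteq> 0}"
    have un: "?S = ?A \<union> ?B" by (auto simp: zero_prod_def prod_eq_iff)
    have "fst (\<Sum>\<gamma>\<in>?S. c \<gamma>) = (\<Sum>\<gamma>\<in>?A. fst (c \<gamma>))"
      and "snd (\<Sum>\<gamma>\<in>?S. c \<gamma>) = (\<Sum>\<gamma>\<in>?B. snd (c \<gamma>))" if "finite ?S"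
      using that unfolding fst_sum snd_sum
      by (auto intro!: sum.mono_neutral_right simp: zero_prod_def prod_eq_iff)
    then show ?thesis
      unfolding is_decomposition_def direct_sum_grading_def
      using un by (auto simp: prod_eq_iff mem_Times_iff)
  qed
  show ?thesis
  proof unfold_locales
    show "P.p.subspace (direct_sum_grading T V \<gamma>)" for \<gamma>
      unfolding direct_sum_grading_def
      by (intro P.subspace_Times T.subspace_grade V.subspace_grade)
    show "\<exists>!c. is_decomposition (direct_sum_grading T V) u c" for u
    proof -
      obtain c d where c: "is_decomposition T (fst u) c" and d: "is_decomposition V (snd u) d"
        using T.decomposition V.decomposition by metis
      show ?thesis
      proof (rule ex1I)
        show "is_decomposition (direct_sum_grading T V) u (\<lambda>\<gamma>. (c \<gamma>, d \<gamma>))"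
          using c d by (simp add: eq comp_def)
        fix e assume "is_decomposition (direct_sum_grading T V) u e"
        then have "fst \<circ> e = c" "snd \<circ> e = d"
          using eq c d T.decomposition V.decomposition by blast+
        then show "e = (\<lambda>\<gamma>. (c \<gamma>, d \<gamma>))" by auto
      qed
    qed
  qed
qed

lemma (in graded_vector_space) component_homogeneous:
  assumes "x \<in> T \<alpha>"
  shows "component T x = (\<lambda>\<delta>. if \<delta> = \<alpha> then x else 0)"
  unfolding component_def
  using decomposition[of x] decomposition_homogeneous[OF assms] by (blast intro: the1_equality)

lemma (in color_representation) semidirect_bracket_homogeneous:
  assumes "x \<in> T \<alpha>" "a \<in> V \<alpha>" "y \<in> T \<beta>" "b \<in> V \<beta>" "z \<in> T \<gamma>" "c \<in> V \<gamma>"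
  shows "semidirect_bracket \<epsilon> T br scaleV V \<theta> (x, a) (y, b) (z, c) =
    (br x y z,
     scaleV (\<epsilon> \<alpha> (\<beta> + \<gamma>)) (\<theta> y z a) - scaleV (\<epsilon> \<beta> \<gamma>) (\<theta> x z b)
       + D_op \<epsilon> scaleV \<theta> \<alpha> \<beta> x y c)"
proof -
  interpret P: graded_vector_space "module_prod.scale scaleT scaleV" "direct_sum_grading T V"
    by (rule direct_sum_graded) unfold_locales
  note zero [simp] = module_hom.zero[OF Vector_Spaces.linear.axioms(3)[OF linear_1]]
    module_hom.zero[OF Vector_Spaces.linear.axioms(3)[OF linear_2]]
    module_hom.zero[OF Vector_Spaces.linear.axioms(3)[OF linear_3]]
    module_hom.zero[OF Vector_Spaces.linear.axioms(3)[OF theta_linear_1]]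
    module_hom.zero[OF Vector_Spaces.linear.axioms(3)[OF theta_linear_2]]
    module_hom.zero[OF Vector_Spaces.linear.axioms(3)[OF theta_End]]
  have comp: "component (direct_sum_grading T V) w = (\<lambda>\<delta>. if \<delta> = \<mu> then w else 0)"
    if "w \<in> T \<mu> \<times> V \<mu>" for w \<mu>
    using P.component_homogeneous that unfolding direct_sum_grading_def by blast
  have one: "(\<Sum>\<delta> | component (direct_sum_grading T V) w \<delta> \<noteq> 0.
      f \<delta> (component (direct_sum_grading T V) w \<delta>)) = f \<mu> w"
    if "w \<in> T \<mu> \<times> V \<mu>" "f \<mu> 0 = 0" for w \<mu> and f :: "'g \<Rightarrow> 't \<times> 'v \<Rightarrow> 't \<times> 'v"
  proof -
    have "{\<delta>. (if \<delta> = \<mu> then w else 0) \<noteq> 0} = (if w = 0 then {} else {\<mu>})" by auto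
    then show ?thesis using that by (auto simp: comp)
  qed
  have formula_0: "semidirect_formula \<epsilon> br scaleV \<theta> \<alpha> \<beta> \<gamma> 0 v w = 0"
    "semidirect_formula \<epsilon> br scaleV \<theta> \<alpha> \<beta> \<gamma> u 0 w = 0"
    "semidirect_formula \<epsilon> br scaleV \<theta> \<alpha> \<beta> \<gamma> u v 0 = 0" for \<alpha> \<beta> \<gamma> u v w
    by (cases u; cases v; cases w; simp add: zero_prod_def D_op_def)+
  have "semidirect_bracket \<epsilon> T br scaleV V \<theta> (x, a) (y, b) (z, c)
      = semidirect_formula \<epsilon> br scaleV \<theta> \<alpha> \<beta> \<gamma> (x, a) (y, b) (z, c)"
    unfolding semidirect_bracket_def trilinear_extension_def
    using assms
      one[where w = "(z, c)" and \<mu> = \<gamma> and f = "\<lambda>\<delta>. semidirect_formula \<epsilon> br scaleV \<theta> _ _ \<delta> _ _"]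
      one[where w = "(y, b)" and \<mu> = \<beta> and
        f = "\<lambda>\<delta> v. semidirect_formula \<epsilon> br scaleV \<theta> _ \<delta> \<gamma> _ v (z, c)"]
      one[where w = "(x, a)" and \<mu> = \<alpha> and
        f = "\<lambda>\<delta> u. semidirect_formula \<epsilon> br scaleV \<theta> \<delta> \<beta> \<gamma> u (y, b) (z, c)"]
    by (simp add: formula_0 del: semidirect_formula.simps)
  then show ?thesis by simp
qed

end

theory Submission
  imports Defs
begin

text \<open>
  The \<open>p\<close>-map does not depend on the bases: \<open>(x, a)\<close> is sent to \<open>x\<^sup>[\<^sup>p\<^sup>]\<close> together with \<open>\<theta>(x, x)\<close>
  applied \<open>(p - 1) / 2\<close> times to \<open>a\<close>, for every homogeneous \<open>(x, a)\<close> with degree in \<open>G\<^sub>+\<close>. Since a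
  bracket with two entries from \<open>V\<close> vanishes, taking the \<open>V\<close>-part of a left-normed product is a
  derivation along the projection to \<open>T\<close>, so each axiom reduces to a sum of products in which one
  entry \<open>b\<close> runs through the positions occupied by \<open>y\<close>.

  In any color triple system with \<open>y\<close>, \<open>b\<close> of degree \<open>\<gamma>\<close>, \<open>\<epsilon>(\<gamma>, \<gamma>) = 1\<close> and \<open>e = \<epsilon>(deg x, \<gamma>)\<close>, right
  multiplication by \<open>(x, y, \<dots>, y)\<close> expands like \<open>(R - e L)\<^sup>k\<close> for the commuting operations \<open>R\<close> and
  \<open>L\<close> of putting a factor \<open>y\<close> behind or in front of \<open>x\<close>. Modulo \<open>p\<close> the binomial coefficients of
  \<open>(R - e L)\<^sup>p\<close> and \<open>(R - e L)\<^sup>p\<^sup>-\<^sup>1\<close> collapse, which gives the bracket axiom directly; applied to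
  \<open>Z x + y\<close> and \<open>Z a + b\<close> over the polynomials in \<open>Z\<close>, it identifies the \<open>V\<close>-part of
  \<open>\<Sum> i s\<^sub>i Z\<^sup>i\<^sup>-\<^sup>1\<close> with a formal derivative, which gives the additivity axiom.
\<close>

section \<open>Triadditive brackets\<close>

text \<open>Scalars are left out on purpose: this structure passes to polynomials with coefficients
  in an abelian group, and identities between such operations can be tested on monomials.\<close>

locale triadditive =
  fixes br :: "'t::ab_group_add \<Rightarrow> 't \<Rightarrow> 't \<Rightarrow> 't"
  assumes add_1: "br (x + x') y z = br x y z + br x' y z"
    and add_2: "br x (y + y') z = br x y z + br x y' z"
    and add_3: "br x y (z + z') = br x y z + br x y z'"
begin

lemma bracket_zero [simp]: "br 0 y z = 0" "br x 0 z = 0" "br x y 0 = 0"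
  using add_1[of 0 0] add_2[of _ 0 0] add_3[of _ _ 0 0] by auto

lemma sum_1: "br (\<Sum>i\<in>A. f i) y z = (\<Sum>i\<in>A. br (f i) y z)"
  by (induction A rule: infinite_finite_induct) (auto simp: add_1)

end

section \<open>Left-normed products under homomorphisms and derivations\<close>

lemma iter_bracket_append:
  "odd (length xs) \<Longrightarrow> iter_bracket br (xs @ ys) = iter_bracket br (iter_bracket br xs # ys)"
  \<comment> \<open>Each recursion step consumes two entries, so a prefix of odd length collapses to
    one element; one of even length would end in \<open>undefined\<close>.\<close>
  by (induction br xs rule: iter_bracket.induct) auto

lemma iter_bracket_snoc2:
  "odd (length xs) \<Longrightarrow> iter_bracket br (xs @ [y, z]) = br (iter_bracket br xs) y z"
  by (simp add: iter_bracket_append)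

lemma replicate_snoc2: "replicate n y @ [y, y] = y # y # replicate n y"
  by (induction n) auto

lemma replicate_Suc_snoc: "replicate (Suc n) a @ xs = replicate n a @ a # xs"
  by (induction n) auto

lemma iter_bracket_replicate_Suc:
  "iter_bracket br (x # replicate (2 * Suc k) y) = br (iter_bracket br (x # replicate (2 * k) y)) y y"
proof -
  have "x # replicate (2 * Suc k) y = (x # replicate (2 * k) y) @ [y, y]"
    by (simp add: replicate_snoc2)
  then show ?thesis
    using iter_bracket_snoc2[of "x # replicate (2 * k) y" br y y] by simp
qed

text \<open>Instances to come: the projections \<open>fst\<close> and \<open>T_part\<close>, the
  coefficientwise map \<open>map_poly fst\<close>, and the evaluations of polynomials at Z = 1
  (\<open>coeff_sum\<close>) and at Z = 0 (coefficient 0).\<close>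

lemma iter_bracket_map_hom:
  assumes "\<And>u v w. f (br u v w) = br' (f u) (f v) (f w)" and "odd (length xs)"
  shows "f (iter_bracket br xs) = iter_bracket br' (map f xs)"
  using assms(2)
proof (induction "length xs" arbitrary: xs rule: less_induct)
  case less
  consider (one) a where "xs = [a]" | (more) a b c r where "xs = a # b # c # r"
    using less.prems by (metis One_nat_def Suc_length_conv even_Suc length_0_conv neq_Nil_conv odd_one)
  then show ?case
    by cases (use less in \<open>auto simp: assms(1)\<close>)
qed

lemma (in triadditive) iter_bracket_add:
  "even (length zs) \<Longrightarrow>
    iter_bracket br ((u + v) # zs) = iter_bracket br (u # zs) + iter_bracket br (v # zs)"
proof (induction "length zs" arbitrary: zs u v rule: less_induct)
  case less
  show ?case
  proof (cases zs)
    case Nil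
    then show ?thesis by simp
  next
    case (Cons a list)
    with less.prems obtain b r where "list = b # r" by (cases list) auto
    with Cons less show ?thesis by (simp add: add_1)
  qed
qed

text \<open>A derivation along a homomorphism \<open>g\<close> satisfies the Leibniz rule on left-normed products.
  It is applied to the \<open>V\<close>-part along the \<open>T\<close>-part, and to \<open>d/dZ\<close> along the identity.\<close>

lemma iter_bracket_leibniz:
  assumes br: "triadditive br'"
    and g: "\<And>u v w. g (br u v w) = br' (g u) (g v) (g w)"
    and h: "\<And>u v w. h (br u v w) = br' (h u) (g v) (g w) + br' (g u) (h v) (g w) + br' (g u) (g v) (h w)"
  shows "h (iter_bracket br (u # replicate (2 * k) w)) =
    iter_bracket br' (h u # replicate (2 * k) (g w)) +
    (\<Sum>i<2 * k. iter_bracket br' (g u # replicate i (g w) @ h w # replicate (2 * k - 1 - i) (g w)))"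
proof (induction k)
  case 0
  then show ?case by simp
next
  case (Suc k)
  interpret triadditive br' by fact
  let ?I = "\<lambda>x. iter_bracket br (x # replicate (2 * k) w)"
  let ?W = "replicate (2 * k) (g w)"
  \<comment> \<open>A product whose special factor sits at one of the first 2k positions just
    receives two more factors \<open>g w\<close> at the end.\<close>
  have step: "iter_bracket br' (g u # replicate i (g w) @ h w # replicate (2 * Suc k - 1 - i) (g w)) =
      br' (iter_bracket br' (g u # replicate i (g w) @ h w # replicate (2 * k - 1 - i) (g w))) (g w) (g w)"
    if "i < 2 * k" for i
  proof -
    have "2 * Suc k - 1 - i = Suc (Suc (2 * k - 1 - i))" using that by simp
    then have "g u # replicate i (g w) @ h w # replicate (2 * Suc k - 1 - i) (g w) =
      (g u # replicate i (g w) @ h w # replicate (2 * k - 1 - i) (g w)) @ [g w, g w]"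
      by (simp add: replicate_snoc2)
    moreover have "odd (length (g u # replicate i (g w) @ h w # replicate (2 * k - 1 - i) (g w)))"
      using that by simp
    ultimately show ?thesis by (metis iter_bracket_snoc2)
  qed
  then have sums: "(\<Sum>i<2 * k. br' (iter_bracket br' (g u # replicate i (g w) @ h w # replicate (2 * k - 1 - i) (g w))) (g w) (g w))
      = (\<Sum>i<2 * k. iter_bracket br' (g u # replicate i (g w) @ h w # replicate (2 * Suc k - 1 - i) (g w)))"
    by (intro sum.cong refl) (simp only: lessThan_iff)
  \<comment> \<open>The new positions 2k and 2k + 1 come from the two Leibniz terms in which
    \<open>h\<close> hits one of the two added factors.\<close>
  have last1: "iter_bracket br' (g u # replicate (2 * k) (g w) @ [h w, g w]) =
      br' (iter_bracket br' (g u # ?W)) (h w) (g w)"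
    and last2: "iter_bracket br' (g u # replicate (Suc (2 * k)) (g w) @ [h w]) =
      br' (iter_bracket br' (g u # ?W)) (g w) (h w)"
    unfolding replicate_Suc_snoc
    using iter_bracket_snoc2[of "g u # ?W" br'] unfolding append_Cons length_Cons length_replicate by force+
  have gI: "g (?I u) = iter_bracket br' (g u # ?W)"
    using iter_bracket_map_hom[of g br br' "u # replicate (2 * k) w"] g by simp
  have "h (iter_bracket br (u # replicate (2 * Suc k) w)) =
      br' (h (?I u)) (g w) (g w) + br' (g (?I u)) (h w) (g w) + br' (g (?I u)) (g w) (h w)"
    unfolding iter_bracket_replicate_Suc h ..
  also have "\<dots> = iter_bracket br' (h u # replicate (2 * Suc k) (g w)) +
     (\<Sum>i<2 * k. iter_bracket br' (g u # replicate i (g w) @ h w # replicate (2 * Suc k - 1 - i) (g w))) +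
     iter_bracket br' (g u # replicate (2 * k) (g w) @ [h w, g w]) +
     iter_bracket br' (g u # replicate (Suc (2 * k)) (g w) @ [h w])"
    unfolding Suc.IH iter_bracket_replicate_Suc add_1 sum_1 last1 last2 gI sums
    by (simp only: add.assoc)
  also have "\<dots> = iter_bracket br' (h u # replicate (2 * Suc k) (g w)) +
     (\<Sum>i<2 * Suc k. iter_bracket br' (g u # replicate i (g w) @ h w # replicate (2 * Suc k - 1 - i) (g w)))"
    by (simp add: add.assoc)
  finally show ?case .
qed

section \<open>Brackets of polynomials\<close>

text \<open>A polynomial is the sum of its monomials. The set \<open>A\<close> confines the
  coefficients: it is \<open>UNIV\<close> for plain identities and a homogeneous component for
  graded ones.\<close>

lemma poly_monom_induct [consumes 1, case_names monom add]:
  fixes q :: "'a::ab_group_add poly"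
  assumes "\<And>i. coeff q i \<in> A"
    and monom: "\<And>a i. a \<in> A \<Longrightarrow> P (monom a i)"
    and add: "\<And>q r. (\<And>i. coeff q i \<in> A) \<Longrightarrow> (\<And>i. coeff r i \<in> A) \<Longrightarrow> P q \<Longrightarrow> P r \<Longrightarrow> P (q + r)"
    and "0 \<in> A" and A_add: "\<And>a b. a \<in> A \<Longrightarrow> b \<in> A \<Longrightarrow> a + b \<in> A"
  shows "P q"
proof -
  \<comment> \<open>That the partial sums have coefficients in \<open>A\<close> is proved along the
    way, since \<open>add\<close> asks for it.\<close>
  have "(\<forall>i. coeff (\<Sum>i\<in>B. monom (coeff q i) i) i \<in> A) \<and> P (\<Sum>i\<in>B. monom (coeff q i) i)"
    if "finite B" for B
    using that
  proof induction
    case empty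
    show ?case using monom[OF \<open>0 \<in> A\<close>, of 0] \<open>0 \<in> A\<close> by simp
  next
    case (insert j B)
    have "coeff (monom (coeff q j) j) i \<in> A" for i
      using assms(1) \<open>0 \<in> A\<close> by simp
    with insert show ?case
      using add[of "monom (coeff q j) j" "\<Sum>i\<in>B. monom (coeff q i) i"] monom[OF assms(1)[of j], of j]
        A_add
      by simp
  qed
  from this[of "{..degree q}"] show ?thesis by (simp add: poly_as_sum_of_monoms)
qed

text \<open>Three nested inductions over sums of monomials. The target is any abelian group, which
  covers identities between single coefficients or sums of coefficients.\<close>

lemma poly_triadditive_eqI:
  fixes F G :: "'a::ab_group_add poly \<Rightarrow> 'a poly \<Rightarrow> 'a poly \<Rightarrow> 'b::ab_group_add"
  assumes "\<And>f f' g h. F (f + f') g h = F f g h + F f' g h"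
    and "\<And>f g g' h. F f (g + g') h = F f g h + F f g' h"
    and "\<And>f g h h'. F f g (h + h') = F f g h + F f g h'"
    and "\<And>f f' g h. G (f + f') g h = G f g h + G f' g h"
    and "\<And>f g g' h. G f (g + g') h = G f g h + G f g' h"
    and "\<And>f g h h'. G f g (h + h') = G f g h + G f g h'"
    and "\<And>a b c i j k. F (monom a i) (monom b j) (monom c k) = G (monom a i) (monom b j) (monom c k)"
  shows "F f g h = G f g h"
proof -
  have "\<And>i. coeff f i \<in> UNIV" "\<And>i. coeff g i \<in> UNIV" "\<And>i. coeff h i \<in> UNIV" by simp_all
  then show ?thesis
  proof (induction f rule: poly_monom_induct)
    case f: (monom a i)
    from f.prems(1) show ?case
    proof (induction g rule: poly_monom_induct)
      case g: (monom b j)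
      from f.prems(2) show ?case
        by (induction h rule: poly_monom_induct) (auto simp: assms)
    qed (auto simp: assms)
  qed (auto simp: assms)
qed

context triadditive
begin

text \<open>The definition cuts the sums off at the degrees, which behave badly under addition; a
  common bound \<open>N\<close> makes additivity in each argument visible.\<close>

lemma poly_bracket_bounded:
  assumes "degree f \<le> N" "degree g \<le> N" "degree h \<le> N"
  shows "poly_bracket br f g h =
    (\<Sum>i\<le>N. \<Sum>j\<le>N. \<Sum>k\<le>N. monom (br (coeff f i) (coeff g j) (coeff h k)) (i + j + k))"
proof -
  have 3: "(\<Sum>k\<le>degree h. monom (br a b (coeff h k)) (i + k)) = (\<Sum>k\<le>N. monom (br a b (coeff h k)) (i + k))"
    for a b i using assms by (intro sum.mono_neutral_left) (auto simp: coeff_eq_0)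
  have 2: "(\<Sum>j\<le>degree g. \<Sum>k\<le>N. monom (br a (coeff g j) (coeff h k)) (i + j + k)) =
      (\<Sum>j\<le>N. \<Sum>k\<le>N. monom (br a (coeff g j) (coeff h k)) (i + j + k))" for a i
    using assms by (intro sum.mono_neutral_left) (auto simp: coeff_eq_0)
  have 1: "(\<Sum>i\<le>degree f. \<Sum>j\<le>N. \<Sum>k\<le>N. monom (br (coeff f i) (coeff g j) (coeff h k)) (i + j + k)) =
      (\<Sum>i\<le>N. \<Sum>j\<le>N. \<Sum>k\<le>N. monom (br (coeff f i) (coeff g j) (coeff h k)) (i + j + k))"
    using assms by (intro sum.mono_neutral_left) (auto simp: coeff_eq_0)
  show ?thesis unfolding poly_bracket_def 3 2 1 ..
qed

lemma poly_bracket_triadditive: "triadditive (poly_bracket br)"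
proof
  fix f f' g h :: "'t poly"
  define N where "N = max (max (degree f) (degree f')) (max (degree g) (degree h))"
  have "degree f \<le> N" "degree f' \<le> N" "degree (f + f') \<le> N" "degree g \<le> N" "degree h \<le> N"
    by (auto simp: N_def intro: degree_add_le)
  then show "poly_bracket br (f + f') g h = poly_bracket br f g h + poly_bracket br f' g h"
    "poly_bracket br g (f + f') h = poly_bracket br g f h + poly_bracket br g f' h"
    "poly_bracket br g h (f + f') = poly_bracket br g h f + poly_bracket br g h f'"
    by (simp_all add: poly_bracket_bounded[of _ N] add_1 add_2 add_3 flip: sum.distrib add_monom)
qed

lemmas poly_add_1 = triadditive.add_1[OF poly_bracket_triadditive]
  and poly_add_2 = triadditive.add_2[OF poly_bracket_triadditive]
  and poly_add_3 = triadditive.add_3[OF poly_bracket_triadditive]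

lemma poly_bracket_monom:
  "poly_bracket br (monom a i) (monom b j) (monom c k) = monom (br a b c) (i + j + k)"
proof -
  have one: "(\<Sum>l\<le>i + j + k. F l (if n = l then d else 0)) = (F n d :: 't poly)"
    if "n \<le> i + j + k" "\<And>l. F l 0 = 0" for F n and d :: 't
  proof -
    have "(\<Sum>l\<le>i + j + k. F l (if n = l then d else 0)) = (\<Sum>l\<le>i + j + k. if n = l then F n d else 0)"
      using that(2) by (intro sum.cong) auto
    also have "\<dots> = F n d" using that(1) by simp
    finally show ?thesis .
  qed
  have "degree (monom a i) \<le> i + j + k" "degree (monom b j) \<le> i + j + k" "degree (monom c k) \<le> i + j + k"
    by (meson degree_monom_le le_add1 le_add2 order_trans trans_le_add1)+
  then have "poly_bracket br (monom a i) (monom b j) (monom c k) =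
    (\<Sum>i'\<le>i + j + k. \<Sum>j'\<le>i + j + k. \<Sum>k'\<le>i + j + k.
      monom (br (if i = i' then a else 0) (if j = j' then b else 0) (if k = k' then c else 0)) (i' + j' + k'))"
    by (subst poly_bracket_bounded[of _ "i + j + k"]) simp_all
  also have "\<dots> = monom (br a b c) (i + j + k)"
    \<comment> \<open>The sums over k', j' and i' collapse in this order, from the innermost
      outwards.\<close>
    by (subst one[where F = "\<lambda>l d. monom (br _ _ d) (_ + l)"], simp, simp,
        subst one[where F = "\<lambda>l d. monom (br _ d _) (_ + l + _)"], simp, simp,
        subst one[where F = "\<lambda>l d. monom (br d _ _) (l + _ + _)"], simp, simp, rule refl)
  finally show ?thesis .
qed

text \<open>On monomials both sides vanish unless all exponents are 0. This makes evaluation at Z =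
  0 a homomorphism of brackets.\<close>

lemma coeff_0_poly_bracket:
  "coeff (poly_bracket br f g h) 0 = br (coeff f 0) (coeff g 0) (coeff h 0)"
  by (rule poly_triadditive_eqI)
    (auto simp: poly_add_1 poly_add_2 poly_add_3 add_1 add_2 add_3 poly_bracket_monom)

lemma degree_poly_bracket_le:
  "degree (poly_bracket br f g h) \<le> degree f + degree g + degree h"
  unfolding poly_bracket_def
  by (intro degree_sum_le finite_atMost order_trans[OF degree_monom_le]) auto

end

text \<open>Exponents bounded by i, j and k add up to i + j + k only if each attains its
  bound.\<close>

lemma (in triadditive) coeff_poly_bracket_top:
  assumes "degree f \<le> i" "degree g \<le> j" "degree h \<le> k"
  shows "coeff (poly_bracket br f g h) (i + j + k) = br (coeff f i) (coeff g j) (coeff h k)"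
proof -
  have "coeff (poly_bracket br f g h) (i + j + k) =
      (\<Sum>i'\<le>degree f. \<Sum>j'\<le>degree g. \<Sum>k'\<le>degree h.
        if i' + j' + k' = i + j + k then br (coeff f i') (coeff g j') (coeff h k') else 0)"
    by (simp add: poly_bracket_def coeff_sum if_distrib cong: if_cong)
  also have "\<dots> = (\<Sum>i'\<le>degree f. if i' = i then \<Sum>j'\<le>degree g. if j' = j then \<Sum>k'\<le>degree h.
        if k' = k then br (coeff f i) (coeff g j) (coeff h k) else 0 else 0 else 0)"
  proof (intro sum.cong refl)
    fix i' assume "i' \<in> {..degree f}"
    have "(\<Sum>j'\<le>degree g. \<Sum>k'\<le>degree h.
        if i' + j' + k' = i + j + k then br (coeff f i') (coeff g j') (coeff h k') else 0) =
      (\<Sum>j'\<le>degree g. if i' = i \<and> j' = j then \<Sum>k'\<le>degree h.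
        if k' = k then br (coeff f i) (coeff g j) (coeff h k) else 0 else 0)"
      using assms \<open>i' \<in> {..degree f}\<close> by (intro sum.cong refl) (auto intro!: sum.cong sum.neutral)
    then show "(\<Sum>j'\<le>degree g. \<Sum>k'\<le>degree h.
        if i' + j' + k' = i + j + k then br (coeff f i') (coeff g j') (coeff h k') else 0) =
      (if i' = i then \<Sum>j'\<le>degree g. if j' = j then \<Sum>k'\<le>degree h.
        if k' = k then br (coeff f i) (coeff g j) (coeff h k) else 0 else 0 else 0)"
      by auto
  qed
  also have "\<dots> = br (coeff f i) (coeff g j) (coeff h k)"
    using assms by (auto simp: coeff_eq_0)
  finally show ?thesis .
qed

text \<open>Each factor contributes at most one power of Z, so the coefficient of Z^(2k + 1) takes
  the linear coefficient from every factor. The degree bound lets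
  \<open>coeff_poly_bracket_top\<close> apply at the next step.\<close>

lemma (in triadditive) iter_poly_bracket_top:
  assumes "degree f \<le> 1" "degree g \<le> 1"
  shows "degree (iter_bracket (poly_bracket br) (f # replicate (2 * k) g)) \<le> Suc (2 * k)"
    and "coeff (iter_bracket (poly_bracket br) (f # replicate (2 * k) g)) (Suc (2 * k)) =
      iter_bracket br (coeff f 1 # replicate (2 * k) (coeff g 1))"
proof (induction k)
  case 0
  {
    case 1
    then show ?case using assms by simp
  next
    case 2
    then show ?case by simp
  }
next
  case (Suc k)
  {
    case 1
    then show ?case
      using degree_poly_bracket_le[of "iter_bracket (poly_bracket br) (f # replicate (2 * k) g)" g g]
        Suc(1) assms unfolding iter_bracket_replicate_Suc by simp
  next
    case 2
    then show ?case
      using coeff_poly_bracket_top[OF Suc(1) assms(2,2)] Suc(2) unfolding iter_bracket_replicate_Suc by simp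
  }
qed

lemma map_poly_add:
  assumes "\<And>a b. f (a + b) = f a + f b"
  shows "map_poly f (q + r) = map_poly f q + (map_poly f r :: 'b::ab_group_add poly)"
proof -
  have "f 0 = 0" using assms[of 0 0] by simp
  then show ?thesis by (intro poly_eqI) (simp add: coeff_map_poly assms)
qed

lemma map_poly_bracket_hom:
  assumes "triadditive br" "triadditive br'"
    and add: "\<And>a b. g (a + b) = g a + g b"
    and hom: "\<And>u v w. g (br u v w) = br' (g u) (g v) (g w)"
  shows "map_poly g (poly_bracket br u v w) = poly_bracket br' (map_poly g u) (map_poly g v) (map_poly g w)"
proof -
  interpret A: triadditive br by fact
  interpret B: triadditive br' by fact
  have "g 0 = 0" using add[of 0 0] by simp
  show ?thesis
    by (rule poly_triadditive_eqI)
      (simp_all add: map_poly_add[of g, OF add] A.poly_add_1 A.poly_add_2 A.poly_add_3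
        B.poly_add_1 B.poly_add_2 B.poly_add_3 map_poly_monom \<open>g 0 = 0\<close>
        A.poly_bracket_monom B.poly_bracket_monom hom)
qed

text \<open>On monomials all three terms carry the same exponent, which leaves the identity for
  coefficients. The case in use is \<open>V_part\<close> along \<open>T_part\<close>.\<close>

lemma map_poly_bracket_derivation:
  assumes "triadditive br" "triadditive br'"
    and g: "\<And>a b. g (a + b) = g a + g b" and h: "\<And>a b. h (a + b) = h a + h b"
    and der: "\<And>u v w. h (br u v w) = br' (h u) (g v) (g w) + br' (g u) (h v) (g w) + br' (g u) (g v) (h w)"
  shows "map_poly h (poly_bracket br u v w) = poly_bracket br' (map_poly h u) (map_poly g v) (map_poly g w)
    + poly_bracket br' (map_poly g u) (map_poly h v) (map_poly g w)
    + poly_bracket br' (map_poly g u) (map_poly g v) (map_poly h w)"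
proof -
  interpret A: triadditive br by fact
  interpret B: triadditive br' by fact
  have "g 0 = 0" "h 0 = 0" using g[of 0 0] h[of 0 0] by simp_all
  show ?thesis
    by (rule poly_triadditive_eqI[where F = "\<lambda>u v w. map_poly h (poly_bracket br u v w)"])
      (simp_all add: map_poly_add[of g, OF g] map_poly_add[of h, OF h] A.poly_add_1 A.poly_add_2 A.poly_add_3
        B.poly_add_1 B.poly_add_2 B.poly_add_3 map_poly_monom
        A.poly_bracket_monom B.poly_bracket_monom \<open>g 0 = 0\<close> \<open>h 0 = 0\<close> der add_ac add_monom)
qed

section \<open>Coefficient sums and formal derivatives\<close>

text \<open>Evaluation at Z = 1, written without a multiplication on the coefficients.\<close>

definition coeff_sum :: "'a::ab_group_add poly \<Rightarrow> 'a" where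
  "coeff_sum f = (\<Sum>i\<le>degree f. coeff f i)"

lemma coeff_sum_bounded: "degree f \<le> N \<Longrightarrow> coeff_sum f = (\<Sum>i\<le>N. coeff f i)"
  unfolding coeff_sum_def by (intro sum.mono_neutral_left) (auto simp: coeff_eq_0)

lemma coeff_sum_add: "coeff_sum (f + g) = coeff_sum f + coeff_sum g"
proof -
  define N where "N = max (degree f) (degree g)"
  have "degree f \<le> N" "degree g \<le> N" "degree (f + g) \<le> N"
    by (auto simp: N_def intro: degree_add_le)
  then show ?thesis by (simp add: coeff_sum_bounded[of _ N] sum.distrib)
qed

lemma coeff_sum_monom: "coeff_sum (monom a n) = a"
  by (simp add: coeff_sum_bounded[OF degree_monom_le])

lemma (in triadditive) coeff_sum_poly_bracket:
  "coeff_sum (poly_bracket br f g h) = br (coeff_sum f) (coeff_sum g) (coeff_sum h)"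
  by (rule poly_triadditive_eqI)
    (auto simp: poly_add_1 poly_add_2 poly_add_3 add_1 add_2 add_3 poly_bracket_monom
      coeff_sum_add coeff_sum_monom)

text \<open>The formal derivative d/dZ. The integer factors act through the field, so they vanish at
  multiples of the characteristic.\<close>

definition poly_deriv :: "('k::field \<Rightarrow> 'a::ab_group_add \<Rightarrow> 'a) \<Rightarrow> 'a poly \<Rightarrow> 'a poly" where
  "poly_deriv sc f = Abs_poly (\<lambda>n. sc (of_nat (Suc n)) (coeff f (Suc n)))"

context vector_space
begin

lemma coeff_poly_deriv: "coeff (poly_deriv scale f) n = scale (of_nat (Suc n)) (coeff f (Suc n))"
proof -
  have "eventually (\<lambda>n. scale (of_nat (Suc n)) (coeff f (Suc n)) = 0) cofinite"
    unfolding MOST_nat by (rule exI[of _ "degree f"]) (auto simp: coeff_eq_0)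
  then show ?thesis unfolding poly_deriv_def by (subst Abs_poly_inverse) auto
qed

lemma poly_deriv_add: "poly_deriv scale (f + g) = poly_deriv scale f + poly_deriv scale g"
  by (intro poly_eqI) (simp add: coeff_poly_deriv scale_right_distrib)

lemma poly_deriv_monom: "poly_deriv scale (monom a n) = monom (scale (of_nat n) a) (n - 1)"
  by (intro poly_eqI) (cases n; auto simp: coeff_poly_deriv)

lemma poly_deriv_poly_bracket:
  assumes "triadditive br"
    and 1: "\<And>c u v w. br (scale c u) v w = scale c (br u v w)"
    and 2: "\<And>c u v w. br u (scale c v) w = scale c (br u v w)"
    and 3: "\<And>c u v w. br u v (scale c w) = scale c (br u v w)"
  shows "poly_deriv scale (poly_bracket br f g h) = poly_bracket br (poly_deriv scale f) g h
    + poly_bracket br f (poly_deriv scale g) h + poly_bracket br f g (poly_deriv scale h)"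
proof -
  interpret triadditive br by fact
  have mono: "poly_deriv scale (poly_bracket br (monom a i) (monom b j) (monom c k)) =
      poly_bracket br (poly_deriv scale (monom a i)) (monom b j) (monom c k)
      + poly_bracket br (monom a i) (poly_deriv scale (monom b j)) (monom c k)
      + poly_bracket br (monom a i) (monom b j) (poly_deriv scale (monom c k))" for a b c i j k
  proof -
    \<comment> \<open>For i = 0 the truncated difference i - 1 gives a wrong exponent, but then the
      scalar factor is 0.\<close>
    have "monom (scale (of_nat i) d) (i - 1 + j + k) = monom (scale (of_nat i) d) (i + j + k - 1)"
      "monom (scale (of_nat j) d) (i + (j - 1) + k) = monom (scale (of_nat j) d) (i + j + k - 1)"
      "monom (scale (of_nat k) d) (i + j + (k - 1)) = monom (scale (of_nat k) d) (i + j + k - 1)" for d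
      by (cases i; cases j; cases k; simp)+
    then show ?thesis
      by (simp only: poly_deriv_monom poly_bracket_monom 1 2 3 add_monom of_nat_add scale_left_distrib)
  qed
  show ?thesis
    by (rule poly_triadditive_eqI[where F = "\<lambda>f g h. poly_deriv scale (poly_bracket br f g h)"])
      (simp_all add: poly_add_1 poly_add_2 poly_add_3 poly_deriv_add add_ac mono)
qed

end

section \<open>Left-normed products in color triple systems\<close>

lemma nmult_Suc: "nmult (Suc n) \<gamma> = nmult n \<gamma> + \<gamma>"
  by (simp add: nmult_def)

lemma nmult_0 [simp]: "nmult 0 \<gamma> = 0"
  by (simp add: nmult_def)

context bicharacter
begin

lemma eps_zero [simp]: "\<epsilon> 0 \<beta> = 1" "\<epsilon> \<alpha> 0 = 1"
  using eps_add_left[of 0 0 \<beta>] eps_add_right[of \<alpha> 0 0] eps_nonzero[of 0 \<beta>] eps_nonzero[of \<alpha> 0] by auto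

lemma eps_nmult_left: "\<epsilon> (nmult n \<alpha>) \<beta> = \<epsilon> \<alpha> \<beta> ^ n"
  by (induction n) (auto simp: nmult_Suc eps_add_left)

lemma eps_nmult_right: "\<epsilon> \<alpha> (nmult n \<beta>) = \<epsilon> \<alpha> \<beta> ^ n"
  by (induction n) (auto simp: nmult_Suc eps_add_right)

lemma eps_cancel: "\<epsilon> \<alpha> \<beta> * (\<epsilon> \<beta> \<alpha> * c) = c"
  by (simp add: eps_inverse flip: mult.assoc)

end

section \<open>Pascal's rule and binomial coefficients modulo p\<close>

lemma (in vector_space) sum_choose_Suc:
  "(\<Sum>i\<le>Suc n. scale (of_nat (Suc n choose i) * c ^ i) (g i)) =
    (\<Sum>i\<le>n. scale (of_nat (n choose i) * c ^ i) (g i + scale c (g (Suc i))))"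
proof -
  \<comment> \<open>With S the shift of sequences, this is (1 + c S)^(n + 1) = (1 + c S)^n (1 + c
    S), applied to \<open>g\<close> and read off at index 0.\<close>
  have "(\<Sum>i\<le>Suc n. scale (of_nat (Suc n choose i) * c ^ i) (g i)) =
      g 0 + (\<Sum>i\<le>n. scale (of_nat ((n choose i) + (n choose Suc i)) * c ^ Suc i) (g (Suc i)))"
    by (subst sum.atMost_Suc_shift) (simp flip: of_nat_add)
  also have "\<dots> = (g 0 + (\<Sum>i\<le>n. scale (of_nat (n choose Suc i) * c ^ Suc i) (g (Suc i))))
      + (\<Sum>i\<le>n. scale (of_nat (n choose i) * c ^ Suc i) (g (Suc i)))"
    by (simp add: algebra_simps sum.distrib scale_left_distrib)
  also have "g 0 + (\<Sum>i\<le>n. scale (of_nat (n choose Suc i) * c ^ Suc i) (g (Suc i))) =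
      (\<Sum>i\<le>Suc n. scale (of_nat (n choose i) * c ^ i) (g i))"
    by (subst sum.atMost_Suc_shift) simp
  also have "\<dots> = (\<Sum>i\<le>n. scale (of_nat (n choose i) * c ^ i) (g i))"
    by (simp add: binomial_eq_0)
  finally show ?thesis
    by (simp add: scale_right_distrib sum.distrib mult_ac)
qed

lemma of_nat_choose_prime_char:
  assumes "prime p" "CHAR('k::comm_ring_1) = p" "0 < j" "j < p"
  shows "(of_nat (p choose j) :: 'k) = 0"
  using assms dvd_choose_prime[of j p] by (simp add: of_nat_eq_0_iff_char_dvd)

text \<open>The inner entries of row p vanish, so by Pascal's rule neighbours in row p - 1 are
  opposite, starting from 1.\<close>

lemma of_nat_choose_pred_prime_char:
  assumes "prime p" "CHAR('k::comm_ring_1) = p" "j < p"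
  shows "(of_nat (p - 1 choose j) :: 'k) = (- 1) ^ j"
  using assms(3)
proof (induction j)
  case 0
  show ?case by simp
next
  case (Suc j)
  obtain q where q: "p = Suc q" using Suc.prems by (cases p) auto
  have "(of_nat (p choose Suc j) :: 'k) = of_nat (p - 1 choose j) + of_nat (p - 1 choose Suc j)"
    by (simp add: q)
  with Suc of_nat_choose_prime_char[OF assms(1,2), of "Suc j"] show ?case
    by (simp add: eq_neg_iff_add_eq_0 add.commute)
qed

text \<open>The axioms on homogeneous elements, with linearity spelled out and components that are
  merely subspaces, so that one calculus serves T, the semidirect product and the polynomials over
  it.\<close>

locale color_triple =
  bicharacter \<epsilon> + vector_space sc + triadditive br
  for \<epsilon> :: "'g::ab_group_add \<Rightarrow> 'g \<Rightarrow> 'k::field"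
    and sc :: "'k \<Rightarrow> 't::ab_group_add \<Rightarrow> 't"
    and br :: "'t \<Rightarrow> 't \<Rightarrow> 't \<Rightarrow> 't" +
  fixes T :: "'g \<Rightarrow> 't set"
  assumes subspace: "subspace (T \<gamma>)"
    and bracket_scale_1: "br (sc c x) y z = sc c (br x y z)"
    and bracket_scale_2: "br x (sc c y) z = sc c (br x y z)"
    and bracket_scale_3: "br x y (sc c z) = sc c (br x y z)"
    and bracket_graded: "\<lbrakk>x \<in> T i; y \<in> T j; z \<in> T k\<rbrakk> \<Longrightarrow> br x y z \<in> T (i + j + k)"
    and bracket_skew: "\<lbrakk>x \<in> T \<alpha>; y \<in> T \<beta>; z \<in> T \<gamma>\<rbrakk> \<Longrightarrow> br x y z = - sc (\<epsilon> \<alpha> \<beta>) (br y x z)"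
    and bracket_cyclic: "\<lbrakk>x \<in> T \<alpha>; y \<in> T \<beta>; z \<in> T \<gamma>\<rbrakk> \<Longrightarrow>
      sc (\<epsilon> \<gamma> \<alpha>) (br x y z) + sc (\<epsilon> \<alpha> \<beta>) (br y z x) + sc (\<epsilon> \<beta> \<gamma>) (br z x y) = 0"
    and bracket_derivation: "\<lbrakk>u \<in> T \<mu>; v \<in> T \<nu>; x \<in> T \<alpha>; y \<in> T \<beta>; z \<in> T \<gamma>\<rbrakk> \<Longrightarrow>
      br u v (br x y z) =
        br (br u v x) y z
        + sc (\<epsilon> (\<mu> + \<nu>) \<alpha>) (br x (br u v y) z)
        + sc (\<epsilon> (\<mu> + \<nu>) (\<alpha> + \<beta>)) (br x y (br u v z))"
begin

lemma bracket_minus: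
  "br (- x) y z = - br x y z" "br x (- y) z = - br x y z" "br x y (- z) = - br x y z"
  using bracket_scale_1[of "-1"] bracket_scale_2[of _ "-1"] bracket_scale_3[of _ _ "-1"] by auto

lemma bracket_diff:
  "br (x - x') y z = br x y z - br x' y z"
  "br x (y - y') z = br x y z - br x y' z"
  "br x y (z - z') = br x y z - br x y z'"
  using add_1[of x "- x'"] add_2[of x y "- y'"] add_3[of x y z "- z'"] by (simp_all add: bracket_minus)

text \<open>The cyclic identity, multiplied by \<open>\<epsilon> \<alpha> \<gamma>\<close>, isolates
  [x, y, z]; skew-symmetry turns [y, z, x] into [z, y, x], so that both remaining products start
  with z.\<close>

lemma bracket_flip:
  assumes "x \<in> T \<alpha>" "y \<in> T \<beta>" "z \<in> T \<gamma>"
  shows "br x y z = - sc (\<epsilon> (\<alpha> + \<beta>) \<gamma>) (br z x y - sc (\<epsilon> \<alpha> \<beta>) (br z y x))"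
proof -
  have "sc (\<epsilon> \<alpha> \<gamma>) (sc (\<epsilon> \<gamma> \<alpha>) (br x y z)) =
      - sc (\<epsilon> \<alpha> \<gamma>) (sc (\<epsilon> \<alpha> \<beta>) (br y z x) + sc (\<epsilon> \<beta> \<gamma>) (br z x y))"
    using bracket_cyclic[OF assms] unfolding scale_minus_right[symmetric]
    by (metis add.assoc eq_neg_iff_add_eq_0)
  then show ?thesis
    by (simp add: eps_inverse eps_add_left bracket_skew[OF assms(2,3,1)] scale_right_diff_distrib
        scale_right_distrib mult_ac algebra_simps)
qed

text \<open>The next two identities say that right multiplication by \<open>[x, y, z]\<close> in the standard
  embedding is the iterated color commutator of the right multiplications by \<open>x\<close>, \<open>y\<close> and \<open>z\<close>.\<close>

lemma bracket_expand_3: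
  assumes w: "w \<in> T \<mu>" and t: "t \<in> T \<tau>" and x: "x \<in> T \<alpha>" and y: "y \<in> T \<beta>" and z: "z \<in> T \<gamma>"
  shows "br w t (br x y z) = br (br w t x) y z - sc (\<epsilon> \<alpha> \<beta>) (br (br w t y) x z)
    - sc (\<epsilon> (\<alpha> + \<beta>) \<gamma>) (br (br w t z) x y - sc (\<epsilon> \<alpha> \<beta>) (br (br w t z) y x))"
proof -
  \<comment> \<open>After \<open>bracket_derivation\<close>, the inner products [w, t, y] and
    [w, t, z] are brought to the front; the bicharacter values between the degrees of w, t and those
    passed over cancel.\<close>
  have "sc (\<epsilon> (\<mu> + \<tau>) \<alpha>) (br x (br w t y) z) = - sc (\<epsilon> \<alpha> \<beta>) (br (br w t y) x z)"
    by (simp add: bracket_skew[OF x bracket_graded[OF w t y] z] eps_add_right[of \<alpha> "\<mu> + \<tau>"] eps_cancel)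
  moreover have "sc (\<epsilon> (\<mu> + \<tau>) (\<alpha> + \<beta>)) (br x y (br w t z)) =
      - sc (\<epsilon> (\<alpha> + \<beta>) \<gamma>) (br (br w t z) x y - sc (\<epsilon> \<alpha> \<beta>) (br (br w t z) y x))"
    by (simp add: bracket_flip[OF x y bracket_graded[OF w t z]] eps_add_right[of "\<alpha> + \<beta>" "\<mu> + \<tau>"] eps_cancel)
  ultimately show ?thesis
    unfolding bracket_derivation[OF w t x y z] by simp
qed

lemma bracket_expand_2:
  assumes w: "w \<in> T \<mu>" and t: "t \<in> T \<tau>" and x: "x \<in> T \<alpha>" and y: "y \<in> T \<beta>" and z: "z \<in> T \<gamma>"
  shows "br w (br x y z) t = br (br w x y) z t - sc (\<epsilon> \<alpha> \<beta>) (br (br w y x) z t)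
    - sc (\<epsilon> (\<alpha> + \<beta>) \<gamma>) (br (br w z x) y t - sc (\<epsilon> \<alpha> \<beta>) (br (br w z y) x t))"
proof -
  define C where "C = br (br w z t) x y - sc (\<epsilon> \<alpha> \<beta>) (br (br w z t) y x)"
  define A where "A = br (br w x y) z t - sc (\<epsilon> \<alpha> \<beta>) (br (br w y x) z t)"
  define B where "B = br (br w z x) y t - sc (\<epsilon> \<alpha> \<beta>) (br (br w z y) x t)"
  \<comment> \<open>The operation [x, y, _] is applied to [w, z, t]. Flipping as in 1, and the
    derivation rule together with 2 and 3, produce \<open>C\<close> with the same factor; it cancels
    and leaves a formula for [w, [x, y, z], t].\<close>
  have 1: "br x y (br w z t) = - sc (\<epsilon> (\<alpha> + \<beta>) (\<mu> + \<gamma> + \<tau>)) C"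
    unfolding C_def by (rule bracket_flip[OF x y bracket_graded[OF w z t]])
  have 2: "br (br x y w) z t = - sc (\<epsilon> (\<alpha> + \<beta>) \<mu>) A"
    by (simp add: bracket_flip[OF x y w] A_def bracket_minus bracket_diff bracket_scale_1)
  have 3: "br w z (br x y t) = B - sc (\<epsilon> (\<alpha> + \<beta>) \<tau>) C"
    unfolding B_def C_def by (rule bracket_expand_3[OF w z x y t])
  have "sc (\<epsilon> \<mu> (\<alpha> + \<beta>)) (br x y (br w z t)) =
      sc (\<epsilon> \<mu> (\<alpha> + \<beta>)) (br (br x y w) z t) + br w (br x y z) t
      + sc (\<epsilon> (\<alpha> + \<beta>) \<gamma>) (br w z (br x y t))"
    by (simp add: bracket_derivation[OF x y w z t] scale_right_distrib eps_inverse
        eps_add_right[of "\<alpha> + \<beta>" \<mu> \<gamma>] eps_cancel)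
  then have "br w (br x y z) t = A - sc (\<epsilon> (\<alpha> + \<beta>) \<gamma>) B"
    unfolding 1 2 3
    by (simp add: scale_right_diff_distrib eps_inverse eps_cancel eps_add_right[of "\<alpha> + \<beta>"] mult.assoc)
      (simp add: algebra_simps)
  then show ?thesis unfolding A_def B_def .
qed

lemma iter_bracket_scale:
  "even (length zs) \<Longrightarrow> iter_bracket br (sc c u # zs) = sc c (iter_bracket br (u # zs))"
proof (induction "length zs" arbitrary: zs u rule: less_induct)
  case less
  show ?case
  proof (cases zs)
    case Nil
    then show ?thesis by simp
  next
    case (Cons a list)
    with less.prems obtain b r where "list = b # r" by (cases list) auto
    with Cons less show ?thesis by (simp add: bracket_scale_1)
  qed
qed

text \<open>Records only that some degree exists: the degrees of the factors around an insertion do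
  not enter the formulas.\<close>

definition homogeneous :: "'t \<Rightarrow> bool" where
  "homogeneous u \<longleftrightarrow> (\<exists>\<delta>. u \<in> T \<delta>)"

lemma homogeneousI: "u \<in> T \<delta> \<Longrightarrow> homogeneous u"
  by (auto simp: homogeneous_def)

lemma homogeneous_iter_bracket:
  assumes "odd (length xs)" "\<forall>u\<in>set xs. homogeneous u"
  shows "homogeneous (iter_bracket br xs)"
  using assms
proof (induction "length xs" arbitrary: xs rule: less_induct)
  case less
  consider (one) a where "xs = [a]" | (more) a b c r where "xs = a # b # c # r"
    using less.prems by (metis One_nat_def Suc_length_conv even_Suc length_0_conv neq_Nil_conv odd_one)
  then show ?case
  proof cases
    case more
    then have "homogeneous (br a b c)"
      using less.prems bracket_graded by (fastforce simp: homogeneous_def)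
    with more less show ?thesis by simp
  qed (use less.prems in auto)
qed

lemma iter_bracket_replicate_in:
  assumes "u \<in> T \<delta>" "y \<in> T \<gamma>"
  shows "iter_bracket br (u # replicate (2 * k) y) \<in> T (\<delta> + nmult (2 * k) \<gamma>)"
proof (induction k)
  case 0
  then show ?case using assms by simp
next
  case (Suc k)
  have "\<delta> + nmult (2 * k) \<gamma> + \<gamma> + \<gamma> = \<delta> + nmult (2 * Suc k) \<gamma>"
    by (simp add: nmult_Suc add.assoc)
  with bracket_graded[OF Suc assms(2) assms(2)] show ?case
    unfolding iter_bracket_replicate_Suc by simp
qed

end

section \<open>Insertion of products with a repeated factor y\<close>

locale color_triple_power = color_triple \<epsilon> sc br T
  for \<epsilon> :: "'g::ab_group_add \<Rightarrow> 'g \<Rightarrow> 'k::field"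
    and sc :: "'k \<Rightarrow> 't::ab_group_add \<Rightarrow> 't"
    and br :: "'t \<Rightarrow> 't \<Rightarrow> 't \<Rightarrow> 't"
    and T :: "'g \<Rightarrow> 't set" +
  fixes \<alpha> \<gamma> :: 'g and x y :: 't and e :: 'k
  assumes x_in: "x \<in> T \<alpha>" and y_in: "y \<in> T \<gamma>" and G_plus: "\<gamma> \<in> G_plus \<epsilon>" and e_def: "e = \<epsilon> \<alpha> \<gamma>"
begin

lemma eps_gamma: "\<epsilon> \<gamma> \<gamma> = 1"
  using G_plus by (simp add: G_plus_def)

abbreviation X :: "nat \<Rightarrow> _" where
  "X k \<equiv> iter_bracket br (x # replicate (2 * k) y)"

lemma X_in: "X k \<in> T (\<alpha> + nmult (2 * k) \<gamma>)"
  by (rule iter_bracket_replicate_in[OF x_in y_in])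

text \<open>Since \<open>\<epsilon> \<gamma> \<gamma> = 1\<close>, further factors y do not change
  the commutation factor. That it stays equal to \<open>e\<close> is what makes powers of one
  operator R - e L appear.\<close>

lemma eps_X: "\<epsilon> (\<alpha> + nmult n \<gamma>) \<gamma> = e"
  by (simp add: eps_add_left eps_nmult_left eps_gamma e_def)

text \<open>With R adding a factor y behind u and L adding one before u, [u, y, y] acts as (R - e
  L)^2 on u. The square is left in nested form so that \<open>sum_choose_Suc\<close> fits twice. The
  leading \<open>b\<close> keeps u out of the first slot.\<close>

lemma insertion_step:
  assumes u: "u \<in> T \<delta>" and eps_u: "\<epsilon> \<delta> \<gamma> = e"
    and b: "homogeneous b" and zs: "\<forall>z\<in>set zs. homogeneous z" and "odd (j + l + length zs)"
  defines "W \<equiv> \<lambda>j u l. iter_bracket br (b # replicate j y @ u # replicate l y @ zs)"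
  shows "W j (br u y y) l = W j u (Suc (Suc l)) + sc (- e) (W (Suc j) u (Suc l))
    + sc (- e) (W (Suc j) u (Suc l) + sc (- e) (W (Suc (Suc j)) u l))"
proof -
  have hom_y: "homogeneous y" using y_in by (rule homogeneousI)
  have prefix: "iter_bracket br ((b # replicate i y) @ us) = iter_bracket br (iter_bracket br (b # replicate i y) # us)"
    if "even i" for i us by (rule iter_bracket_append) (use that in simp)
  have hom_prefix: "homogeneous (iter_bracket br (b # replicate i y))" if "even i" for i
    by (rule homogeneous_iter_bracket) (use that b hom_y in auto)
  show ?thesis
  proof (cases "even j")
    \<comment> \<open>For even j the prefix collapses to \<open>w\<close> and u stands in the middle
      slot of a bracket, the situation of \<open>bracket_expand_2\<close>.\<close>
    case True
    define w where "w = iter_bracket br (b # replicate j y)"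
    have "odd (length (replicate l y @ zs))" using assms(5) True by auto
    then obtain t r where r: "replicate l y @ zs = t # r" and "even (length r)"
      by (cases "replicate l y @ zs") auto
    have "\<forall>z\<in>set (t # r). homogeneous z" unfolding r[symmetric] using hom_y zs by auto
    then obtain \<tau> where t: "t \<in> T \<tau>" by (auto simp: homogeneous_def)
    obtain \<mu> where w: "w \<in> T \<mu>" using hom_prefix[OF True] by (auto simp: w_def homogeneous_def)
    have W: "W j v l = iter_bracket br (br w v t # r)"
      "W j v (Suc (Suc l)) = iter_bracket br (br (br w v y) y t # r)"
      "W (Suc j) v (Suc l) = iter_bracket br (br (br w y v) y t # r)"
      "W (Suc (Suc j)) v l = iter_bracket br (br (br w y y) v t # r)" for v
      unfolding W_def using prefix[OF True] r
      by (simp_all add: w_def replicate_Suc_snoc[unfolded replicate_Suc append_Cons])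
    have "br w (br u y y) t = br (br w u y) y t + sc (- e) (br (br w y u) y t)
        + sc (- e) (br (br w y u) y t + sc (- e) (br (br w y y) u t))"
      using bracket_expand_2[OF w t u y_in y_in] by (simp add: eps_u eps_add_left eps_gamma)
    then show ?thesis
      unfolding W using \<open>even (length r)\<close> by (simp only: iter_bracket_add iter_bracket_scale)
  next
    \<comment> \<open>For odd j one y is left over from the prefix and u stands in the last slot,
      the situation of \<open>bracket_expand_3\<close>.\<close>
    case False
    then obtain i where j: "j = Suc i" and i: "even i" by (cases j) auto
    define w where "w = iter_bracket br (b # replicate i y)"
    define r where "r = replicate l y @ zs"
    have "even (length r)" using assms(5) False by (auto simp: r_def)
    obtain \<mu> where w: "w \<in> T \<mu>" using hom_prefix[OF i] by (auto simp: w_def homogeneous_def)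
    have W: "W j v l = iter_bracket br (br w y v # r)"
      "W j v (Suc (Suc l)) = iter_bracket br (br (br w y v) y y # r)"
      "W (Suc j) v (Suc l) = iter_bracket br (br (br w y y) v y # r)"
      "W (Suc (Suc j)) v l = iter_bracket br (br (br w y y) y v # r)" for v
      unfolding W_def j replicate_Suc_snoc[of i] replicate_Suc_snoc[of "Suc i"]
        replicate_Suc_snoc[of "Suc (Suc i)"]
      by (simp_all only: prefix[OF i, unfolded append_Cons] replicate_Suc append_Cons
          r_def[symmetric] w_def[symmetric] iter_bracket.simps)
    have "br w y (br u y y) = br (br w y u) y y + sc (- e) (br (br w y y) u y)
        + sc (- e) (br (br w y y) u y + sc (- e) (br (br w y y) y u))"
      using bracket_expand_3[OF w y_in u y_in y_in] by (simp add: eps_u eps_add_left eps_gamma)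
    then show ?thesis
      unfolding W using \<open>even (length r)\<close> by (simp only: iter_bracket_add iter_bracket_scale)
  qed
qed

text \<open>The binomial expansion of (R - e L)^(2k), where i counts the factors y moved in front of
  x. The induction peels off one square by \<open>insertion_step\<close>, which shifts j and
  l.\<close>

lemma insertion_expand:
  assumes b: "homogeneous b" and zs: "\<forall>z\<in>set zs. homogeneous z" and "odd (j + l + length zs)"
  defines "W \<equiv> \<lambda>j u l. iter_bracket br (b # replicate j y @ u # replicate l y @ zs)"
  shows "W j (X k) l = (\<Sum>i\<le>2 * k. sc (of_nat (2 * k choose i) * (- e) ^ i) (W (j + i) x (l + 2 * k - i)))"
  using assms(3)
proof (induction k arbitrary: j l)
  case 0
  then show ?case by simp
next
  case (Suc k)
  \<comment> \<open>All three words of \<open>insertion_step\<close> expand over this one sequence,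
    shifted by 0, 1 and 2.\<close>
  define g where "g i = W (j + i) x (l + 2 * Suc k - i)" for i
  have "W j (X (Suc k)) l = W j (X k) (Suc (Suc l)) + sc (- e) (W (Suc j) (X k) (Suc l))
    + sc (- e) (W (Suc j) (X k) (Suc l) + sc (- e) (W (Suc (Suc j)) (X k) l))"
    unfolding iter_bracket_replicate_Suc W_def by (rule insertion_step[OF X_in eps_X b zs Suc.prems])
  also have "\<dots> = (\<Sum>i\<le>2 * k. sc (of_nat (2 * k choose i) * (- e) ^ i)
     ((g i + sc (- e) (g (Suc i))) + sc (- e) (g (Suc i) + sc (- e) (g (Suc (Suc i))))))"
  proof -
    have "W j (X k) (Suc (Suc l)) = (\<Sum>i\<le>2 * k. sc (of_nat (2 * k choose i) * (- e) ^ i) (g i))"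
      "W (Suc j) (X k) (Suc l) = (\<Sum>i\<le>2 * k. sc (of_nat (2 * k choose i) * (- e) ^ i) (g (Suc i)))"
      "W (Suc (Suc j)) (X k) l = (\<Sum>i\<le>2 * k. sc (of_nat (2 * k choose i) * (- e) ^ i) (g (Suc (Suc i))))"
      using Suc.prems unfolding g_def by (subst Suc.IH; force)+
    then show ?thesis
      by (simp only: scale_sum_right scale_right_distrib sum.distrib scale_scale mult_ac)
  qed
  also have "\<dots> = (\<Sum>i\<le>Suc (Suc (2 * k)). sc (of_nat (Suc (Suc (2 * k)) choose i) * (- e) ^ i) (g i))"
    by (simp only: sum_choose_Suc)
  finally show ?case by (simp add: g_def)
qed

text \<open>The factor b is moved to the front past the block (x, y, ..., y), which costs - e; the
  block is then expanded by (R - e L)^i.\<close>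

lemma single_insertion:
  assumes b: "b \<in> T \<gamma>" and zs: "\<forall>z\<in>set zs. homogeneous z" and "odd (i + l + length zs)"
  defines "W \<equiv> \<lambda>j l. iter_bracket br (b # replicate j y @ x # replicate l y @ zs)"
  shows "iter_bracket br (x # replicate i y @ b # replicate l y @ zs) =
    - (\<Sum>j\<le>i. sc (e * of_nat (i choose j) * (- e) ^ j) (W j (i + l - j)))"
proof -
  have hb: "homogeneous b" using b by (rule homogeneousI)
  show ?thesis
  proof (cases "even i")
    \<comment> \<open>For even i, b stands in the middle slot and skew-symmetry moves it to the
      front.\<close>
    case True
    then obtain k where k: "i = 2 * k" by auto
    define r where "r = replicate l y @ zs"
    have "odd (length r)" using assms(3) True by (auto simp: r_def)
    moreover have "\<forall>z\<in>set r. homogeneous z" unfolding r_def using zs homogeneousI[OF y_in] by auto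
    ultimately obtain t r' where r: "r = t # r'" and "even (length r')" and "homogeneous t"
      by (cases r) auto
    then obtain \<tau> where t: "t \<in> T \<tau>" by (auto simp: homogeneous_def)
    have "iter_bracket br (x # replicate i y @ b # r) = iter_bracket br (br (X k) b t # r')"
      using iter_bracket_append[of "x # replicate i y" br "b # r"] by (simp add: k r)
    also have "br (X k) b t = sc (- e) (br b (X k) t)"
      by (simp add: bracket_skew[OF X_in b t] eps_X)
    also have "iter_bracket br (\<dots> # r') = sc (- e) (iter_bracket br (b # X k # r))"
      using \<open>even (length r')\<close> by (simp only: iter_bracket_scale r iter_bracket.simps)
    also have "iter_bracket br (b # X k # r) =
        (\<Sum>j\<le>2 * k. sc (of_nat (2 * k choose j) * (- e) ^ j) (W j (l + 2 * k - j)))"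
      using insertion_expand[OF hb zs, of 0 l k] assms(3) True by (simp add: r_def W_def)
    finally show ?thesis
      by (simp add: r_def k scale_sum_right mult.assoc add.commute[of l] sum_negf)
  next
    \<comment> \<open>For odd i, b stands in the last slot. Flipping gives two words, which Pascal's
      rule merges into the expansion with exponent i = 2k + 1.\<close>
    case False
    then obtain k where k: "i = Suc (2 * k)" by (auto elim: oddE)
    define r where "r = replicate l y @ zs"
    have "even (length r)" using assms(3) False by (auto simp: r_def)
    have "replicate i y @ b # r = replicate (2 * k) y @ y # b # r"
      unfolding k by (rule replicate_Suc_snoc)
    then have "iter_bracket br (x # replicate i y @ b # r) = iter_bracket br (br (X k) y b # r)"
      using iter_bracket_append[of "x # replicate (2 * k) y" br "y # b # r"] by simp
    also have "br (X k) y b = sc (- e) (br b (X k) y + sc (- e) (br b y (X k)))"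
      by (simp add: bracket_flip[OF X_in y_in b] eps_add_left eps_X eps_gamma)
        (simp add: eps_X flip: eps_add_left)
    also have "iter_bracket br (\<dots> # r) =
        sc (- e) (iter_bracket br (b # X k # y # r) + sc (- e) (iter_bracket br (b # y # X k # r)))"
      using \<open>even (length r)\<close> by (simp only: iter_bracket_scale iter_bracket_add iter_bracket.simps)
    also have "iter_bracket br (b # X k # y # r) =
        (\<Sum>j\<le>2 * k. sc (of_nat (2 * k choose j) * (- e) ^ j) (W j (Suc l + 2 * k - j)))"
      using insertion_expand[OF hb zs, of 0 "Suc l" k] assms(3) False by (simp add: r_def W_def)
    also have "iter_bracket br (b # y # X k # r) =
        (\<Sum>j\<le>2 * k. sc (of_nat (2 * k choose j) * (- e) ^ j) (W (Suc j) (Suc l + 2 * k - Suc j)))"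
      using insertion_expand[OF hb zs, of 1 l k] assms(3) False by (simp add: r_def W_def)
    also have "(\<Sum>j\<le>2 * k. sc (of_nat (2 * k choose j) * (- e) ^ j) (W j (Suc l + 2 * k - j))) +
        sc (- e) (\<Sum>j\<le>2 * k. sc (of_nat (2 * k choose j) * (- e) ^ j) (W (Suc j) (Suc l + 2 * k - Suc j))) =
        (\<Sum>j\<le>2 * k. sc (of_nat (2 * k choose j) * (- e) ^ j)
          (W j (Suc l + 2 * k - j) + sc (- e) (W (Suc j) (Suc l + 2 * k - Suc j))))"
      by (simp only: scale_sum_right scale_right_distrib sum.distrib scale_scale mult_ac)
    also have "\<dots> = (\<Sum>j\<le>i. sc (of_nat (i choose j) * (- e) ^ j) (W j (Suc l + 2 * k - j)))"
      unfolding k by (rule sum_choose_Suc[symmetric])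
    finally show ?thesis
      unfolding r_def scale_sum_right
      by (simp add: k add.commute[of l] mult.assoc sum_negf del: sum.atMost_Suc binomial_Suc_Suc)
  qed
qed

text \<open>\<open>single_insertion\<close> is summed over all positions i; after exchanging the
  sums, the hockey-stick identity turns the sum of the i choose j into q choose j + 1.\<close>

lemma sum_insertions:
  assumes b: "b \<in> T \<gamma>" and zs: "\<forall>z\<in>set zs. homogeneous z" and "even (q + length zs)" and "0 < q"
  shows "(\<Sum>i<q. iter_bracket br (x # replicate i y @ b # replicate (q - 1 - i) y @ zs)) =
    - (\<Sum>j<q. sc (e * of_nat (q choose Suc j) * (- e) ^ j)
         (iter_bracket br (b # replicate j y @ x # replicate (q - 1 - j) y @ zs)))"
proof -
  define W where "W j = iter_bracket br (b # replicate j y @ x # replicate (q - 1 - j) y @ zs)" for j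
  have "iter_bracket br (x # replicate i y @ b # replicate (q - 1 - i) y @ zs) =
      - (\<Sum>j<q. sc (e * of_nat (i choose j) * (- e) ^ j) (W j))" if "i < q" for i
  proof -
    have "iter_bracket br (x # replicate i y @ b # replicate (q - 1 - i) y @ zs) =
      - (\<Sum>j\<le>i. sc (e * of_nat (i choose j) * (- e) ^ j) (W j))"
      using single_insertion[OF b zs, of i "q - 1 - i"] assms(3) that by (simp add: W_def)
    also have "(\<Sum>j\<le>i. sc (e * of_nat (i choose j) * (- e) ^ j) (W j)) =
        (\<Sum>j<q. sc (e * of_nat (i choose j) * (- e) ^ j) (W j))"
      using that by (intro sum.mono_neutral_left) (auto simp: binomial_eq_0)
    finally show ?thesis .
  qed
  then have "(\<Sum>i<q. iter_bracket br (x # replicate i y @ b # replicate (q - 1 - i) y @ zs)) =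
      - (\<Sum>i<q. \<Sum>j<q. sc (e * of_nat (i choose j) * (- e) ^ j) (W j))"
    by (simp add: sum_negf)
  also have "(\<Sum>i<q. \<Sum>j<q. sc (e * of_nat (i choose j) * (- e) ^ j) (W j)) =
      (\<Sum>j<q. sc (e * of_nat (q choose Suc j) * (- e) ^ j) (W j))"
  proof (subst sum.swap, intro sum.cong refl)
    fix j
    have "(\<Sum>i<q. i choose j) = q choose Suc j"
      using sum_choose_upper[of j "q - 1"] \<open>0 < q\<close> by (cases q) (auto simp: lessThan_Suc_atMost)
    then show "(\<Sum>i<q. sc (e * of_nat (i choose j) * (- e) ^ j) (W j)) =
        sc (e * of_nat (q choose Suc j) * (- e) ^ j) (W j)"
      by (simp flip: scale_sum_left sum_distrib_left sum_distrib_right of_nat_sum)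
  qed
  finally show ?thesis unfolding W_def .
qed

text \<open>Modulo p only j = p - 1 survives in \<open>sum_insertions\<close>, the word in which all
  factors y stand between b and x. The left-hand side is the part of (x, y + b, ..., y + b, z) that
  is linear in b.\<close>

lemma sum_insertions_prime:
  assumes "prime p" "CHAR('k) = p" "odd p" and b: "b \<in> T \<gamma>" and z: "z \<in> T \<zeta>"
  shows "(\<Sum>i<p. iter_bracket br (x # replicate i y @ b # replicate (p - 1 - i) y @ [z])) =
    br x (iter_bracket br (b # replicate (p - 1) y)) z"
proof -
  obtain m where m: "p = Suc (2 * m)" using \<open>odd p\<close> by (auto elim: oddE)
  define B where "B = iter_bracket br (b # replicate (2 * m) y)"
  have B: "B \<in> T (\<gamma> + nmult (2 * m) \<gamma>)"
    unfolding B_def by (rule iter_bracket_replicate_in[OF b y_in])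
  define W where "W j = iter_bracket br (b # replicate j y @ x # replicate (p - 1 - j) y @ [z])" for j
  have "(\<Sum>i<p. iter_bracket br (x # replicate i y @ b # replicate (p - 1 - i) y @ [z])) =
      - (\<Sum>j<p. sc (e * of_nat (p choose Suc j) * (- e) ^ j) (W j))"
    unfolding W_def by (rule sum_insertions[OF b]) (use z \<open>odd p\<close> in \<open>auto intro: homogeneousI odd_pos\<close>)
  also have "(\<Sum>j<p. sc (e * of_nat (p choose Suc j) * (- e) ^ j) (W j)) =
      (\<Sum>j\<in>{2 * m}. sc (e * of_nat (p choose Suc j) * (- e) ^ j) (W j))"
  proof (intro sum.mono_neutral_right ballI)
    fix j assume "j \<in> {..<p} - {2 * m}"
    then have "(of_nat (p choose Suc j) :: 'k) = 0"
      by (intro of_nat_choose_prime_char[OF assms(1,2)]) (auto simp: m)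
    then show "sc (e * of_nat (p choose Suc j) * (- e) ^ j) (W j) = 0" by (simp only:) simp
  qed (auto simp: m)
  also have "\<dots> = sc (e ^ p) (br B x z)"
    using iter_bracket_append[of "b # replicate (2 * m) y" br "[x, z]"]
    by (simp add: m W_def B_def)
  \<comment> \<open>\<open>B\<close> has degree p times \<open>\<gamma>\<close>, so exchanging it
    with x costs the factor - e^p.\<close>
  also have "- \<dots> = br x B z"
    unfolding bracket_skew[OF x_in B z] by (simp add: eps_add_right eps_nmult_right m flip: e_def)
  finally show ?thesis by (simp add: B_def m)
qed

text \<open>For e = 1 the coefficients p - 1 choose j + 1 equal (-1)^(j + 1) and all signs cancel.
  This exchange of x and b serves to recognize a formal derivative.\<close>

lemma sum_insertions_pred_prime:
  assumes "prime p" "CHAR('k) = p" "odd p" and b: "b \<in> T \<gamma>" and "e = 1"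
  shows "(\<Sum>i<p - 1. iter_bracket br (x # replicate i y @ b # replicate (p - 2 - i) y)) =
    (\<Sum>i<p - 1. iter_bracket br (b # replicate i y @ x # replicate (p - 2 - i) y))"
proof -
  have "0 < p - 1" using prime_gt_1_nat[OF \<open>prime p\<close>] by simp
  have "(\<Sum>i<p - 1. iter_bracket br (x # replicate i y @ b # replicate (p - 1 - 1 - i) y @ [])) =
    - (\<Sum>j<p - 1. sc (e * of_nat (p - 1 choose Suc j) * (- e) ^ j)
         (iter_bracket br (b # replicate j y @ x # replicate (p - 1 - 1 - j) y @ [])))"
    by (rule sum_insertions[OF b]) (use \<open>odd p\<close> \<open>0 < p - 1\<close> in auto)
  also have "\<dots> = (\<Sum>j<p - 1. iter_bracket br (b # replicate j y @ x # replicate (p - 1 - 1 - j) y @ []))"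
    unfolding sum_negf[symmetric]
  proof (intro sum.cong refl)
    fix j assume "j \<in> {..<p - 1}"
    then have "(of_nat (p - 1 choose Suc j) :: 'k) = (- 1) ^ Suc j"
      by (intro of_nat_choose_pred_prime_char[OF assms(1,2)]) auto
    moreover have "(- 1) ^ Suc j * (- 1) ^ j = (- 1 :: 'k)"
      by (simp flip: power_mult_distrib)
    ultimately show "- sc (e * of_nat (p - 1 choose Suc j) * (- e) ^ j) w = w" for w
      using \<open>e = 1\<close> by (simp only: mult_1) simp
  qed
  finally show ?thesis by (simp add: numeral_2_eq_2)
qed

text \<open>Flipping c to the front leaves two sums whose coefficients are powers of e. They are
  consecutive shifts of one sequence, so their difference telescopes to its first and last words.
  Products ending in an element of V are thereby reduced to products starting with it.\<close>

lemma bracket_power_flip: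
  assumes "prime p" "CHAR('k) = p" "odd p" and c: "c \<in> T \<zeta>"
  shows "br (iter_bracket br (x # replicate (p - 1) y)) y c =
    - sc (\<epsilon> (\<alpha> + nmult p \<gamma>) \<zeta>)
      (iter_bracket br (c # x # replicate p y) - sc (e ^ p) (iter_bracket br (c # replicate p y @ [x])))"
proof -
  obtain m where m: "p = Suc (2 * m)" using \<open>odd p\<close> by (auto elim: oddE)
  define G where "G i = sc (e ^ i) (iter_bracket br (c # replicate i y @ x # replicate (p - i) y))" for i
  have coeff: "of_nat (2 * m choose i) * (- e) ^ i = e ^ i" if "i \<le> 2 * m" for i
  proof -
    have "(of_nat (2 * m choose i) :: 'k) = (- 1) ^ i"
      using of_nat_choose_pred_prime_char[OF assms(1,2), of i] that by (simp add: m)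
    then show ?thesis by (simp flip: power_mult_distrib)
  qed
  have "br c (X m) y = (\<Sum>i\<le>2 * m. G i)"
    using insertion_expand[OF homogeneousI[OF c], of "[]" 0 1 m] by (simp add: G_def m coeff)
  moreover have "sc e (br c y (X m)) = (\<Sum>i\<le>2 * m. G (Suc i))"
    using insertion_expand[OF homogeneousI[OF c], of "[]" 1 0 m]
    by (simp add: G_def m coeff scale_sum_right)
  ultimately have "br c (X m) y - sc e (br c y (X m)) = (\<Sum>i\<le>2 * m. G i - G (Suc i))"
    by (simp add: sum_subtractf)
  also have "\<dots> = iter_bracket br (c # x # replicate p y) - sc (e ^ p) (iter_bracket br (c # replicate p y @ [x]))"
    by (simp only: sum_telescope) (simp add: G_def m)
  finally have "br c (X m) y - sc e (br c y (X m)) = \<dots>" .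
  moreover have "\<alpha> + nmult (2 * m) \<gamma> + \<gamma> = \<alpha> + nmult p \<gamma>" and "2 * m = p - 1"
    by (simp_all add: m nmult_Suc add.assoc)
  ultimately show ?thesis
    using bracket_flip[OF X_in[of m] y_in c] by (simp only: eps_X)
qed

end

section \<open>Extension of scalars to polynomials\<close>

text \<open>The variable Z is given degree 0, so no new bicharacter values occur.\<close>

definition poly_grade :: "('g \<Rightarrow> 't::ab_group_add set) \<Rightarrow> 'g \<Rightarrow> 't poly set" where
  "poly_grade T \<gamma> = {f. \<forall>i. coeff f i \<in> T \<gamma>}"

context color_triple
begin

lemma poly_grade_induct [consumes 1, case_names monom add]:
  assumes "f \<in> poly_grade T \<gamma>"
    and "\<And>a i. a \<in> T \<gamma> \<Longrightarrow> P (monom a i)"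
    and "\<And>q r. q \<in> poly_grade T \<gamma> \<Longrightarrow> r \<in> poly_grade T \<gamma> \<Longrightarrow> P q \<Longrightarrow> P r \<Longrightarrow> P (q + r)"
  shows "P f"
proof -
  have "coeff f i \<in> T \<gamma>" for i using assms(1) by (simp add: poly_grade_def)
  then show ?thesis
    by (induction f rule: poly_monom_induct)
      (auto simp: poly_grade_def subspace_0[OF subspace] subspace_add[OF subspace] intro: assms(2,3))
qed

lemma vector_space_poly: "vector_space (\<lambda>c. map_poly (sc c))"
  by unfold_locales (auto intro!: poly_eqI simp: coeff_map_poly scale_right_distrib scale_left_distrib)

text \<open>Every axiom is additive in each argument, which leaves monomials with homogeneous
  coefficients; there all terms have the same exponent.\<close>

lemma poly_color_triple:
  "color_triple \<epsilon> (\<lambda>c. map_poly (sc c)) (poly_bracket br) (poly_grade T)"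
proof -
  let ?sc = "\<lambda>c. map_poly (sc c)"
  interpret P: vector_space ?sc by (rule vector_space_poly)
  interpret B: triadditive "poly_bracket br" by (rule poly_bracket_triadditive)
  have scale_monom: "map_poly (sc c) (monom a i) = monom (sc c a) i" for c a i
    by (simp add: map_poly_monom)
  have minus_monom': "- monom a i = monom (- a) i" for a :: 't and i
    by (simp add: minus_monom)
  note linear = B.add_1 B.add_2 B.add_3 P.scale_right_distrib
  note monomial = poly_bracket_monom scale_monom minus_monom' add_monom
  show ?thesis
  proof (rule color_triple.intro[OF bicharacter_axioms vector_space_poly poly_bracket_triadditive],
      rule color_triple_axioms.intro)
    fix c f g h
    show "poly_bracket br (?sc c f) g h = ?sc c (poly_bracket br f g h)"
      by (rule poly_triadditive_eqI[where F = "\<lambda>f g h. poly_bracket br (?sc c f) g h"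
            and G = "\<lambda>f g h. ?sc c (poly_bracket br f g h)"])
        (simp_all add: linear monomial bracket_scale_1)
    show "poly_bracket br f (?sc c g) h = ?sc c (poly_bracket br f g h)"
      by (rule poly_triadditive_eqI[where F = "\<lambda>f g h. poly_bracket br f (?sc c g) h"
            and G = "\<lambda>f g h. ?sc c (poly_bracket br f g h)"])
        (simp_all add: linear monomial bracket_scale_2)
    show "poly_bracket br f g (?sc c h) = ?sc c (poly_bracket br f g h)"
      by (rule poly_triadditive_eqI[where F = "\<lambda>f g h. poly_bracket br f g (?sc c h)"
            and G = "\<lambda>f g h. ?sc c (poly_bracket br f g h)"])
        (simp_all add: linear monomial bracket_scale_3)
  next
    fix \<gamma>
    show "P.subspace (poly_grade T \<gamma>)"
      by (auto intro!: P.subspaceI simp: poly_grade_def coeff_map_poly subspace_0[OF subspace]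
          subspace_add[OF subspace] subspace_scale[OF subspace])
  next
    fix f g h \<alpha> \<beta> \<gamma>
    assume f: "f \<in> poly_grade T \<alpha>" and g: "g \<in> poly_grade T \<beta>" and h: "h \<in> poly_grade T \<gamma>"
    show "poly_bracket br f g h \<in> poly_grade T (\<alpha> + \<beta> + \<gamma>)"
      using f
    proof (induction f rule: poly_grade_induct)
      case f: (monom a i)
      from g show ?case
      proof (induction g rule: poly_grade_induct)
        case g: (monom b j)
        from h show ?case
          by (induction h rule: poly_grade_induct)
            (use f g in \<open>auto simp: linear poly_bracket_monom bracket_graded poly_grade_def
              subspace_0[OF subspace] subspace_add[OF subspace]\<close>)
      qed (auto simp: linear poly_grade_def subspace_add[OF subspace])
    qed (auto simp: linear poly_grade_def subspace_add[OF subspace])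
    show "poly_bracket br f g h = - ?sc (\<epsilon> \<alpha> \<beta>) (poly_bracket br g f h)"
      using f
    proof (induction f rule: poly_grade_induct)
      case f: (monom a i)
      from g show ?case
      proof (induction g rule: poly_grade_induct)
        case g: (monom b j)
        from h show ?case
          by (induction h rule: poly_grade_induct)
            (use f g in \<open>auto simp: linear monomial bracket_skew[OF f g] add_ac\<close>)
      qed (simp add: linear)
    qed (simp add: linear)
    show "?sc (\<epsilon> \<gamma> \<alpha>) (poly_bracket br f g h) + ?sc (\<epsilon> \<alpha> \<beta>) (poly_bracket br g h f)
        + ?sc (\<epsilon> \<beta> \<gamma>) (poly_bracket br h f g) = 0"
      (is "?C f g h = 0")
    proof -
      have C_add: "?C (f + f') g h = ?C f g h + ?C f' g h" "?C f (g + g') h = ?C f g h + ?C f g' h"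
        "?C f g (h + h') = ?C f g h + ?C f g h'" for f f' g g' h h'
        by (simp_all add: linear add_ac)
      show ?thesis
        using f
      proof (induction f rule: poly_grade_induct)
        case f: (monom a i)
        from g show ?case
        proof (induction g rule: poly_grade_induct)
          case g: (monom b j)
          from h show ?case
          proof (induction h rule: poly_grade_induct)
            case h: (monom c k)
            have "j + k + i = i + j + k" "k + i + j = i + j + k" by simp_all
            then show ?case by (simp only: monomial bracket_cyclic[OF f g h]) simp
          qed (simp add: C_add del: P.scale_right_distrib)
        qed (simp add: C_add)
      qed (simp add: C_add)
    qed
  next
    fix u v f g h \<mu> \<nu> \<alpha> \<beta> \<gamma>
    assume u: "u \<in> poly_grade T \<mu>" and v: "v \<in> poly_grade T \<nu>"
      and f: "f \<in> poly_grade T \<alpha>" and g: "g \<in> poly_grade T \<beta>" and h: "h \<in> poly_grade T \<gamma>"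
    let ?P = "poly_bracket br"
    \<comment> \<open>The five nested inductions use the right-hand side as one expression that is
      additive in each argument.\<close>
    define R where "R u v f g h = ?P (?P u v f) g h + ?sc (\<epsilon> (\<mu> + \<nu>) \<alpha>) (?P f (?P u v g) h)
        + ?sc (\<epsilon> (\<mu> + \<nu>) (\<alpha> + \<beta>)) (?P f g (?P u v h))" for u v f g h
    have R_add: "R (u + u') v f g h = R u v f g h + R u' v f g h" "R u (v + v') f g h = R u v f g h + R u v' f g h"
      "R u v (f + f') g h = R u v f g h + R u v f' g h" "R u v f (g + g') h = R u v f g h + R u v f g' h"
      "R u v f g (h + h') = R u v f g h + R u v f g h'" for u u' v v' f f' g g' h h'
      by (simp_all add: R_def linear add_ac)
    have "?P u v (?P f g h) = R u v f g h"
      using u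
    proof (induction u rule: poly_grade_induct)
      case u: (monom a1 i1)
      from v show ?case
      proof (induction v rule: poly_grade_induct)
        case v: (monom a2 i2)
        from f show ?case
        proof (induction f rule: poly_grade_induct)
          case f: (monom a i)
          from g show ?case
          proof (induction g rule: poly_grade_induct)
            case g: (monom b j)
            from h show ?case
            proof (induction h rule: poly_grade_induct)
              case h: (monom c k)
              have "i + (i1 + i2 + j) + k = i1 + i2 + i + j + k" "i1 + i2 + (i + j + k) = i1 + i2 + i + j + k"
                "i + j + (i1 + i2 + k) = i1 + i2 + i + j + k" by simp_all
              then show ?case
                by (simp only: R_def monomial bracket_derivation[OF u v f g h])
            qed (simp add: R_add B.add_3)
          qed (simp add: R_add B.add_2 B.add_3)
        qed (simp add: R_add B.add_1 B.add_3)
      qed (simp add: R_add B.add_2)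
    qed (simp add: R_add B.add_1)
    then show "?P u v (?P f g h) = ?P (?P u v f) g h + ?sc (\<epsilon> (\<mu> + \<nu>) \<alpha>) (?P f (?P u v g) h)
        + ?sc (\<epsilon> (\<mu> + \<nu>) (\<alpha> + \<beta>)) (?P f g (?P u v h))"
      unfolding R_def .
  qed
qed

end

section \<open>Transfer between color triples and Lie color triple systems\<close>

lemma linear_iff_additive_scale:
  assumes "vector_space s1" "vector_space s2"
  shows "Vector_Spaces.linear s1 s2 f \<longleftrightarrow>
    (\<forall>x y. f (x + y) = f x + f y) \<and> (\<forall>c x. f (s1 c x) = s2 c (f x))"
  using assms by (simp add: Vector_Spaces.linear_iff)

sublocale lie_color_triple_system \<subseteq> color_triple \<epsilon> sc br T
proof (rule color_triple.intro[OF bicharacter_axioms vector_space_axioms])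
  note linear = linear_1 linear_2 linear_3
  note lin = linear[unfolded linear_iff_additive_scale[OF vector_space_axioms vector_space_axioms]]
  show "triadditive br"
    by unfold_locales (simp_all add: lin)
  show "color_triple_axioms \<epsilon> sc br T"
    by (rule color_triple_axioms.intro)
      (fact subspace_grade | (simp add: lin; fail) | fact graded | fact skew | fact cyclic | fact derivation)+
qed

lemma (in color_triple) lie_color_triple_systemI:
  assumes "graded_vector_space sc T"
  shows "lie_color_triple_system \<epsilon> sc T br"
proof (rule lie_color_triple_system.intro[OF bicharacter_axioms assms])
  have lin: "Vector_Spaces.linear sc sc (\<lambda>x. br x y z)" "Vector_Spaces.linear sc sc (\<lambda>y. br x y z)"
    "Vector_Spaces.linear sc sc (\<lambda>z. br x y z)" for x y z
    by (simp_all add: linear_iff_additive_scale vector_space_axioms add_1 add_2 add_3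
        bracket_scale_1 bracket_scale_2 bracket_scale_3)
  show "lie_color_triple_system_axioms \<epsilon> sc T br"
    by (rule lie_color_triple_system_axioms.intro)
      (fact lin | fact bracket_graded | fact bracket_skew | fact bracket_cyclic | fact bracket_derivation)+
qed

section \<open>Trilinear extensions\<close>

context graded_vector_space
begin

lemma is_decomposition_component: "is_decomposition T v (component T v)"
  unfolding component_def by (rule theI'[OF decomposition])

lemma component_eqI: "is_decomposition T v c \<Longrightarrow> component T v = c"
  unfolding component_def by (rule the1_equality[OF decomposition])

lemma component_in: "component T v \<gamma> \<in> T \<gamma>"
  and finite_component: "finite {\<gamma>. component T v \<gamma> \<noteq> 0}"
  and sum_component: "(\<Sum>\<gamma> | component T v \<gamma> \<noteq> 0. component T v \<gamma>) = v"
  using is_decomposition_component[of v] by (auto simp: is_decomposition_def)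

lemma sum_component_superset:
  "finite A \<Longrightarrow> {\<gamma>. component T v \<gamma> \<noteq> 0} \<subseteq> A \<Longrightarrow> (\<Sum>\<gamma>\<in>A. component T v \<gamma>) = v"
  by (subst (2) sum_component[symmetric], rule sum.mono_neutral_right) auto

lemma component_add: "component T (u + v) = (\<lambda>\<gamma>. component T u \<gamma> + component T v \<gamma>)"
proof (rule component_eqI)
  define A where "A = {\<gamma>. component T u \<gamma> \<noteq> 0} \<union> {\<gamma>. component T v \<gamma> \<noteq> 0}"
  have A: "finite A" by (simp add: A_def finite_component)
  have sub: "{\<gamma>. component T u \<gamma> + component T v \<gamma> \<noteq> 0} \<subseteq> A" by (auto simp: A_def)
  have "(\<Sum>\<gamma> | component T u \<gamma> + component T v \<gamma> \<noteq> 0. component T u \<gamma> + component T v \<gamma>) =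
      (\<Sum>\<gamma>\<in>A. component T u \<gamma> + component T v \<gamma>)"
    using A sub by (intro sum.mono_neutral_left) auto
  also have "\<dots> = u + v"
    using A by (simp add: sum.distrib sum_component_superset A_def)
  finally show "is_decomposition T (u + v) (\<lambda>\<gamma>. component T u \<gamma> + component T v \<gamma>)"
    using finite_subset[OF sub A] subspace_add[OF subspace_grade component_in component_in]
    by (simp add: is_decomposition_def)
qed

lemma component_scale: "component T (sc c u) = (\<lambda>\<gamma>. sc c (component T u \<gamma>))"
proof (rule component_eqI)
  define A where "A = {\<gamma>. component T u \<gamma> \<noteq> 0}"
  have A: "finite A" by (simp add: A_def finite_component)
  have sub: "{\<gamma>. sc c (component T u \<gamma>) \<noteq> 0} \<subseteq> A" by (auto simp: A_def)
  have "(\<Sum>\<gamma> | sc c (component T u \<gamma>) \<noteq> 0. sc c (component T u \<gamma>)) = (\<Sum>\<gamma>\<in>A. sc c (component T u \<gamma>))"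
    using A sub by (intro sum.mono_neutral_left) auto
  also have "\<dots> = sc c u"
    using A by (simp add: sum_component_superset A_def flip: scale_sum_right)
  finally show "is_decomposition T (sc c u) (\<lambda>\<gamma>. sc c (component T u \<gamma>))"
    using finite_subset[OF sub A] subspace_scale[OF subspace_grade component_in]
    by (simp add: is_decomposition_def)
qed

text \<open>The supports vary with the arguments; as \<open>F\<close> vanishes once an argument is
  0, they can be replaced by fixed finite sets of degrees, over which the sums are compared.\<close>

lemma trilinear_extension_superset:
  assumes "finite A" "finite B" "finite C" "{\<alpha>. component T u \<alpha> \<noteq> 0} \<subseteq> A"
    "{\<beta>. component T v \<beta> \<noteq> 0} \<subseteq> B" "{\<gamma>. component T w \<gamma> \<noteq> 0} \<subseteq> C"
    and zero: "\<And>\<alpha> \<beta> \<gamma> y z. F \<alpha> \<beta> \<gamma> 0 y z = 0" "\<And>\<alpha> \<beta> \<gamma> x z. F \<alpha> \<beta> \<gamma> x 0 z = 0"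
      "\<And>\<alpha> \<beta> \<gamma> x y. F \<alpha> \<beta> \<gamma> x y 0 = 0"
  shows "trilinear_extension T F u v w =
    (\<Sum>\<alpha>\<in>A. \<Sum>\<beta>\<in>B. \<Sum>\<gamma>\<in>C. F \<alpha> \<beta> \<gamma> (component T u \<alpha>) (component T v \<beta>) (component T w \<gamma>))"
proof -
  have restrict: "(\<Sum>\<gamma> | component T u \<gamma> \<noteq> 0. f \<gamma>) = (\<Sum>\<gamma>\<in>S. f \<gamma>)"
    if "finite S" "{\<gamma>. component T u \<gamma> \<noteq> 0} \<subseteq> S" "\<And>\<gamma>. component T u \<gamma> = 0 \<Longrightarrow> f \<gamma> = 0" for S u and f :: "'g \<Rightarrow> 't"
    using that by (intro sum.mono_neutral_left) auto
  show ?thesis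
    unfolding trilinear_extension_def
    by (simp add: restrict[OF assms(1,4)] restrict[OF assms(2,5)] restrict[OF assms(3,6)] zero)
qed

lemma linear_trilinear_extension:
  assumes 1: "\<And>\<alpha> \<beta> \<gamma> y z. Vector_Spaces.linear sc sc (\<lambda>x. F \<alpha> \<beta> \<gamma> x y z)"
    and 2: "\<And>\<alpha> \<beta> \<gamma> x z. Vector_Spaces.linear sc sc (\<lambda>y. F \<alpha> \<beta> \<gamma> x y z)"
    and 3: "\<And>\<alpha> \<beta> \<gamma> x y. Vector_Spaces.linear sc sc (\<lambda>z. F \<alpha> \<beta> \<gamma> x y z)"
  shows "Vector_Spaces.linear sc sc (\<lambda>u. trilinear_extension T F u v w)"
    and "Vector_Spaces.linear sc sc (\<lambda>u. trilinear_extension T F v u w)"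
    and "Vector_Spaces.linear sc sc (\<lambda>u. trilinear_extension T F v w u)"
proof -
  note lin = 1[unfolded linear_iff_additive_scale[OF vector_space_axioms vector_space_axioms]]
    2[unfolded linear_iff_additive_scale[OF vector_space_axioms vector_space_axioms]]
    3[unfolded linear_iff_additive_scale[OF vector_space_axioms vector_space_axioms]]
  have zero: "F \<alpha> \<beta> \<gamma> 0 y z = 0" "F \<alpha> \<beta> \<gamma> x 0 z = 0" "F \<alpha> \<beta> \<gamma> x y 0 = 0" for \<alpha> \<beta> \<gamma> x y z
    using lin by (metis scale_zero_left)+
  let ?S = "\<lambda>v. {\<gamma>. component T v \<gamma> \<noteq> 0}"
  let ?E = "trilinear_extension T F"
  have add: "?E (u + u') v w = ?E u v w + ?E u' v w \<and> ?E v (u + u') w = ?E v u w + ?E v u' w \<and>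
      ?E v w (u + u') = ?E v w u + ?E v w u'" for u u' v w
  proof -
    define A where "A = ?S u \<union> ?S u' \<union> ?S (u + u') \<union> ?S v \<union> ?S w"
    have A: "finite A" "?S u \<subseteq> A" "?S u' \<subseteq> A" "?S (u + u') \<subseteq> A" "?S v \<subseteq> A" "?S w \<subseteq> A"
      by (auto simp: A_def finite_component)
    note ext = trilinear_extension_superset[where F = F, OF A(1,1,1) _ _ _ zero]
    show ?thesis
      by (simp only: ext A A(4)[unfolded component_add] component_add lin sum.distrib simp_thms)
  qed
  have scale: "?E (sc c u) v w = sc c (?E u v w) \<and> ?E v (sc c u) w = sc c (?E v u w) \<and>
      ?E v w (sc c u) = sc c (?E v w u)" for c u v w
  proof -
    define A where "A = ?S u \<union> ?S (sc c u) \<union> ?S v \<union> ?S w"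
    have A: "finite A" "?S u \<subseteq> A" "?S (sc c u) \<subseteq> A" "?S v \<subseteq> A" "?S w \<subseteq> A"
      by (auto simp: A_def finite_component)
    note ext = trilinear_extension_superset[where F = F, OF A(1,1,1) _ _ _ zero]
    show ?thesis
      by (simp only: ext A A(3)[unfolded component_scale] component_scale lin scale_sum_right simp_thms)
  qed
  show "Vector_Spaces.linear sc sc (\<lambda>u. ?E u v w)" "Vector_Spaces.linear sc sc (\<lambda>u. ?E v u w)"
    "Vector_Spaces.linear sc sc (\<lambda>u. ?E v w u)"
    using add scale by (auto simp: linear_iff_additive_scale[OF vector_space_axioms vector_space_axioms])
qed

end

lemma (in graded_vector_space) homogeneous_induct [case_names homogeneous add]:
  assumes hom: "\<And>\<gamma> x. x \<in> T \<gamma> \<Longrightarrow> P x" and add: "\<And>x y. P x \<Longrightarrow> P y \<Longrightarrow> P (x + y)"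
  shows "P v"
proof -
  have "P (\<Sum>\<gamma>\<in>A. component T v \<gamma>)" if "finite A" for A
    using that
    by induction (use hom[OF subspace_0[OF subspace_grade]] hom[OF component_in] add in auto)
  from this[OF finite_component[of v]] show ?thesis by (simp add: sum_component)
qed

text \<open>Serves to extend the rules for \<open>T_part\<close>, \<open>V_part\<close> and
  \<open>fst\<close> of a bracket from homogeneous elements, where the formula is explicit, to all
  elements.\<close>

lemma (in graded_vector_space) graded_triadditive_eqI:
  fixes F G :: "'t \<Rightarrow> 't \<Rightarrow> 't \<Rightarrow> 'b::ab_group_add"
  assumes "\<And>f f' g h. F (f + f') g h = F f g h + F f' g h"
    and "\<And>f g g' h. F f (g + g') h = F f g h + F f g' h"
    and "\<And>f g h h'. F f g (h + h') = F f g h + F f g h'"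
    and "\<And>f f' g h. G (f + f') g h = G f g h + G f' g h"
    and "\<And>f g g' h. G f (g + g') h = G f g h + G f g' h"
    and "\<And>f g h h'. G f g (h + h') = G f g h + G f g h'"
    and "\<And>\<alpha> \<beta> \<gamma> f g h. f \<in> T \<alpha> \<Longrightarrow> g \<in> T \<beta> \<Longrightarrow> h \<in> T \<gamma> \<Longrightarrow> F f g h = G f g h"
  shows "F f g h = G f g h"
proof (induction f rule: homogeneous_induct)
  case f: (homogeneous \<alpha> f)
  show ?case
  proof (induction g rule: homogeneous_induct)
    case g: (homogeneous \<beta> g)
    show ?case
      by (induction h rule: homogeneous_induct) (use assms(7)[OF f g] in \<open>auto simp: assms(3,6)\<close>)
  qed (simp add: assms)
qed (simp add: assms)

section \<open>The semidirect product\<close>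

context color_representation
begin

abbreviation scaleL :: "'k \<Rightarrow> 't \<times> 'v \<Rightarrow> 't \<times> 'v" where
  "scaleL \<equiv> module_prod.scale scaleT scaleV"

abbreviation L :: "'g \<Rightarrow> ('t \<times> 'v) set" where
  "L \<equiv> direct_sum_grading T V"

abbreviation brL :: "'t \<times> 'v \<Rightarrow> 't \<times> 'v \<Rightarrow> 't \<times> 'v \<Rightarrow> 't \<times> 'v" where
  "brL \<equiv> semidirect_bracket \<epsilon> T br scaleV V \<theta>"

abbreviation D :: "'g \<Rightarrow> 'g \<Rightarrow> 't \<Rightarrow> 't \<Rightarrow> 'v \<Rightarrow> 'v" where
  "D \<equiv> D_op \<epsilon> scaleV \<theta>"

lemma scaleL_Pair: "scaleL c (x, a) = (scaleT c x, scaleV c a)"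
proof -
  interpret P: vector_space_prod scaleT scaleV by unfold_locales
  show ?thesis by (simp add: P.scale_def)
qed

lemma vector_space_L: "vector_space scaleL"
proof -
  interpret P: vector_space_prod scaleT scaleV by unfold_locales
  show ?thesis by unfold_locales
qed

lemma theta_additive:
  "\<theta> (x + x') y a = \<theta> x y a + \<theta> x' y a"
  "\<theta> x (y + y') a = \<theta> x y a + \<theta> x y' a"
  "\<theta> x y (a + b) = \<theta> x y a + \<theta> x y b"
  and theta_scale:
  "\<theta> (scaleT c x) y a = scaleV c (\<theta> x y a)"
  "\<theta> x (scaleT c y) a = scaleV c (\<theta> x y a)"
  "\<theta> x y (scaleV c a) = scaleV c (\<theta> x y a)"
  using theta_linear_1 theta_linear_2 theta_End
  by (simp_all add: Vector_Spaces.linear_iff)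

lemma theta_zero [simp]: "\<theta> 0 y a = 0" "\<theta> x 0 a = 0" "\<theta> x y 0 = 0"
  using theta_scale(1)[of 0 0] theta_scale(2)[of _ 0 0] theta_scale(3)[of _ _ 0 0] by auto

lemma theta_minus: "\<theta> x y (- a) = - \<theta> x y a"
  using theta_scale(3)[of x y "-1" a] by simp

lemma theta_diff: "\<theta> x y (a - b) = \<theta> x y a - \<theta> x y b"
  using theta_additive(3)[of x y a "- b"] by (simp add: theta_minus)

lemma D_add: "D \<alpha> \<beta> x y (a + b) = D \<alpha> \<beta> x y a + D \<alpha> \<beta> x y b"
  by (simp add: D_op_def theta_additive V.scale_right_distrib)

lemma D_scale: "D \<alpha> \<beta> x y (scaleV c a) = scaleV c (D \<alpha> \<beta> x y a)"
  by (simp add: D_op_def theta_scale V.scale_right_diff_distrib mult.commute)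

lemma D_diff: "D \<alpha> \<beta> x y (a - b) = D \<alpha> \<beta> x y a - D \<alpha> \<beta> x y b"
  by (simp add: D_op_def theta_diff V.scale_right_diff_distrib algebra_simps)

lemma D_zero [simp]: "D \<alpha> \<beta> x y 0 = 0"
  by (simp add: D_op_def)

lemma D_in: "x \<in> T \<alpha> \<Longrightarrow> y \<in> T \<beta> \<Longrightarrow> c \<in> V \<mu> \<Longrightarrow> D \<alpha> \<beta> x y c \<in> V (\<mu> + \<alpha> + \<beta>)"
  unfolding D_op_def using rep_1[of x \<alpha> y \<beta> c \<mu>] rep_1[of y \<beta> x \<alpha> c \<mu>]
  by (simp add: V.subspace_diff[OF V.subspace_grade] V.subspace_scale[OF V.subspace_grade] add_ac)

lemma semidirect_in:
  assumes "x \<in> T \<alpha>" "a \<in> V \<alpha>" "y \<in> T \<beta>" "b \<in> V \<beta>" "z \<in> T \<gamma>" "c \<in> V \<gamma>"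
  shows "scaleV (\<epsilon> \<alpha> (\<beta> + \<gamma>)) (\<theta> y z a) - scaleV (\<epsilon> \<beta> \<gamma>) (\<theta> x z b) + D \<alpha> \<beta> x y c \<in> V (\<alpha> + \<beta> + \<gamma>)"
  using rep_1[OF assms(3,5,2)] rep_1[OF assms(1,5,4)] D_in[OF assms(1,3,6)]
  by (simp add: V.subspace_diff[OF V.subspace_grade] V.subspace_scale[OF V.subspace_grade]
      V.subspace_add[OF V.subspace_grade] add_ac)

lemma theta_bracket_right:
  assumes "x \<in> T \<alpha>" "y \<in> T \<beta>" "z \<in> T \<gamma>" "t \<in> T \<delta>"
  shows "\<theta> x (br y z t) a = scaleV (\<epsilon> (\<alpha> + \<beta>) (\<gamma> + \<delta>)) (\<theta> z t (\<theta> x y a))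
    - scaleV (\<epsilon> \<alpha> \<beta> * \<epsilon> (\<alpha> + \<gamma>) \<delta>) (\<theta> y t (\<theta> x z a)) + scaleV (\<epsilon> \<alpha> (\<beta> + \<gamma>)) (D \<beta> \<gamma> y z (\<theta> x t a))"
  using rep_2[OF assms, of a] by (simp add: algebra_simps)

lemma D_theta:
  assumes "x \<in> T \<alpha>" "y \<in> T \<beta>" "z \<in> T \<gamma>" "t \<in> T \<delta>"
  shows "D \<alpha> \<beta> x y (\<theta> z t a) = scaleV (\<epsilon> (\<alpha> + \<beta>) (\<gamma> + \<delta>)) (\<theta> z t (D \<alpha> \<beta> x y a))
      + \<theta> (br x y z) t a + scaleV (\<epsilon> (\<alpha> + \<beta>) \<gamma>) (\<theta> z (br x y t) a)"
  using rep_3[OF assms, of a] by (simp add: algebra_simps)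

text \<open>\<open>D_theta\<close> is applied to both terms of D(x, y), and bicharacter identities
  regroup the result. In the derivation axiom of the semidirect product this is the case where the
  last entry comes from V.\<close>

lemma D_D:
  assumes u: "u \<in> T \<mu>" and v: "v \<in> T \<nu>" and x: "x \<in> T \<alpha>" and y: "y \<in> T \<beta>"
  shows "D \<mu> \<nu> u v (D \<alpha> \<beta> x y c) = D (\<mu> + \<nu> + \<alpha>) \<beta> (br u v x) y c
    + scaleV (\<epsilon> (\<mu> + \<nu>) \<alpha>) (D \<alpha> (\<mu> + \<nu> + \<beta>) x (br u v y) c)
    + scaleV (\<epsilon> (\<mu> + \<nu>) (\<alpha> + \<beta>)) (D \<alpha> \<beta> x y (D \<mu> \<nu> u v c))"
proof -
  have "D \<mu> \<nu> u v (D \<alpha> \<beta> x y c) =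
      scaleV (\<epsilon> \<alpha> \<beta>) (D \<mu> \<nu> u v (\<theta> y x c)) - D \<mu> \<nu> u v (\<theta> x y c)"
    by (simp add: D_op_def[of _ _ _ \<alpha>] D_diff D_scale)
  also have "\<dots> = scaleV (\<epsilon> \<alpha> \<beta>) (scaleV (\<epsilon> (\<mu> + \<nu>) (\<beta> + \<alpha>)) (\<theta> y x (D \<mu> \<nu> u v c))
      + \<theta> (br u v y) x c + scaleV (\<epsilon> (\<mu> + \<nu>) \<beta>) (\<theta> y (br u v x) c))
    - (scaleV (\<epsilon> (\<mu> + \<nu>) (\<alpha> + \<beta>)) (\<theta> x y (D \<mu> \<nu> u v c))
      + \<theta> (br u v x) y c + scaleV (\<epsilon> (\<mu> + \<nu>) \<alpha>) (\<theta> x (br u v y) c))"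
    by (simp only: D_theta[OF u v y x] D_theta[OF u v x y])
  also have "\<dots> = D (\<mu> + \<nu> + \<alpha>) \<beta> (br u v x) y c
    + scaleV (\<epsilon> (\<mu> + \<nu>) \<alpha>) (D \<alpha> (\<mu> + \<nu> + \<beta>) x (br u v y) c)
    + scaleV (\<epsilon> (\<mu> + \<nu>) (\<alpha> + \<beta>)) (D \<alpha> \<beta> x y (D \<mu> \<nu> u v c))"
  proof -
    have 1: "\<epsilon> (\<mu> + \<nu>) \<alpha> * \<epsilon> \<alpha> (\<mu> + \<nu> + \<beta>) = \<epsilon> \<alpha> \<beta>"
      by (simp add: eps_add_right[of \<alpha> "\<mu> + \<nu>" \<beta>] eps_cancel)
    have 2: "\<epsilon> (\<mu> + \<nu> + \<alpha>) \<beta> = \<epsilon> \<alpha> \<beta> * \<epsilon> (\<mu> + \<nu>) \<beta>"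
      by (simp add: eps_add_left[of "\<mu> + \<nu>" \<alpha>])
    have 3: "\<epsilon> (\<mu> + \<nu>) (\<alpha> + \<beta>) * \<epsilon> \<alpha> \<beta> = \<epsilon> \<alpha> \<beta> * \<epsilon> (\<mu> + \<nu>) (\<beta> + \<alpha>)"
      by (simp add: add.commute)
    show ?thesis
      unfolding D_op_def[of _ _ _ "\<mu> + \<nu> + \<alpha>"] D_op_def[of _ _ _ \<alpha> "\<mu> + \<nu> + \<beta>"] D_op_def[of _ _ _ \<alpha> \<beta>]
      by (simp add: V.scale_right_distrib V.scale_right_diff_distrib 1 2 3)
  qed
  finally show ?thesis .
qed

text \<open>For fixed degrees the bicharacter values are constants, so the formula is linear on all
  of T + V, as \<open>linear_trilinear_extension\<close> requires.\<close>

lemma linear_semidirect_formula: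
  "Vector_Spaces.linear scaleL scaleL (\<lambda>u. semidirect_formula \<epsilon> br scaleV \<theta> \<alpha> \<beta> \<gamma> u v w)"
  "Vector_Spaces.linear scaleL scaleL (\<lambda>v. semidirect_formula \<epsilon> br scaleV \<theta> \<alpha> \<beta> \<gamma> u v w)"
  "Vector_Spaces.linear scaleL scaleL (\<lambda>w. semidirect_formula \<epsilon> br scaleV \<theta> \<alpha> \<beta> \<gamma> u v w)"
  by (cases u; cases v; cases w;
      simp add: Vector_Spaces.linear_iff vector_space_L scaleL_Pair add_1 add_2 add_3
        bracket_scale_1 bracket_scale_2 bracket_scale_3 theta_additive theta_scale D_op_def
        V.scale_right_distrib V.scale_right_diff_distrib mult_ac algebra_simps)+

lemma semidirect_skew:
  assumes "x \<in> T \<alpha>" "a \<in> V \<alpha>" "y \<in> T \<beta>" "b \<in> V \<beta>" "z \<in> T \<gamma>" "c \<in> V \<gamma>"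
  shows "brL (x, a) (y, b) (z, c) = - scaleL (\<epsilon> \<alpha> \<beta>) (brL (y, b) (x, a) (z, c))"
  unfolding semidirect_bracket_homogeneous[OF assms(1,2,3,4,5,6)]
    semidirect_bracket_homogeneous[OF assms(3,4,1,2,5,6)]
  by (simp add: scaleL_Pair D_op_def bracket_skew[OF assms(1,3,5)]
      V.scale_right_distrib V.scale_right_diff_distrib eps_add_right eps_inverse eps_cancel mult_ac algebra_simps)

lemma semidirect_cyclic:
  assumes "x \<in> T \<alpha>" "a \<in> V \<alpha>" "y \<in> T \<beta>" "b \<in> V \<beta>" "z \<in> T \<gamma>" "c \<in> V \<gamma>"
  shows "scaleL (\<epsilon> \<gamma> \<alpha>) (brL (x, a) (y, b) (z, c)) + scaleL (\<epsilon> \<alpha> \<beta>) (brL (y, b) (z, c) (x, a))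
    + scaleL (\<epsilon> \<beta> \<gamma>) (brL (z, c) (x, a) (y, b)) = 0"
proof -
  have "\<epsilon> \<gamma> \<alpha> * \<epsilon> \<alpha> (\<beta> + \<gamma>) = \<epsilon> \<alpha> \<beta>" "\<epsilon> \<alpha> \<beta> * \<epsilon> \<beta> (\<gamma> + \<alpha>) = \<epsilon> \<beta> \<gamma>" "\<epsilon> \<beta> \<gamma> * \<epsilon> \<gamma> (\<alpha> + \<beta>) = \<epsilon> \<gamma> \<alpha>" for \<alpha> \<beta> \<gamma>
    by (simp_all add: eps_add_right mult.left_commute eps_inverse)
  then show ?thesis
    using bracket_cyclic[OF assms(1,3,5)]
    unfolding semidirect_bracket_homogeneous[OF assms(1,2,3,4,5,6)]
      semidirect_bracket_homogeneous[OF assms(3,4,5,6,1,2)]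
      semidirect_bracket_homogeneous[OF assms(5,6,1,2,3,4)]
    by (simp add: scaleL_Pair D_op_def zero_prod_def
      V.scale_right_distrib V.scale_right_diff_distrib mult_ac)
qed

text \<open>The V-part is split by the entry taken from V: \<open>D_D\<close> treats c,
  \<open>D_theta\<close> (from \<open>rep_3\<close>) treats a and b, and
  \<open>theta_bracket_right\<close> (from \<open>rep_2\<close>) treats d and f.\<close>

lemma semidirect_derivation:
  assumes u: "u \<in> T \<mu>" "d \<in> V \<mu>" and v: "v \<in> T \<nu>" "f \<in> V \<nu>" and x: "x \<in> T \<alpha>" "a \<in> V \<alpha>"
    and y: "y \<in> T \<beta>" "b \<in> V \<beta>" and z: "z \<in> T \<gamma>" "c \<in> V \<gamma>"
  shows "brL (u, d) (v, f) (brL (x, a) (y, b) (z, c)) =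
    brL (brL (u, d) (v, f) (x, a)) (y, b) (z, c)
    + scaleL (\<epsilon> (\<mu> + \<nu>) \<alpha>) (brL (x, a) (brL (u, d) (v, f) (y, b)) (z, c))
    + scaleL (\<epsilon> (\<mu> + \<nu>) (\<alpha> + \<beta>)) (brL (x, a) (y, b) (brL (u, d) (v, f) (z, c)))"
proof -
  let ?M = "\<mu> + \<nu>"
  define part where "part \<alpha> \<beta> \<gamma> x a y b z c =
    scaleV (\<epsilon> \<alpha> (\<beta> + \<gamma>)) (\<theta> y z a) - scaleV (\<epsilon> \<beta> \<gamma>) (\<theta> x z b) + D \<alpha> \<beta> x y c"
    for \<alpha> \<beta> \<gamma> x a y b z c
  have hom: "brL (x, a) (y, b) (z, c) = (br x y z, part \<alpha> \<beta> \<gamma> x a y b z c)"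
    if "x \<in> T \<alpha>" "a \<in> V \<alpha>" "y \<in> T \<beta>" "b \<in> V \<beta>" "z \<in> T \<gamma>" "c \<in> V \<gamma>" for \<alpha> \<beta> \<gamma> x a y b z c
    unfolding part_def by (rule semidirect_bracket_homogeneous[OF that])
  have part_in: "part \<alpha> \<beta> \<gamma> x a y b z c \<in> V (\<alpha> + \<beta> + \<gamma>)"
    if "x \<in> T \<alpha>" "a \<in> V \<alpha>" "y \<in> T \<beta>" "b \<in> V \<beta>" "z \<in> T \<gamma>" "c \<in> V \<gamma>" for \<alpha> \<beta> \<gamma> x a y b z c
    unfolding part_def by (rule semidirect_in[OF that])
  let ?x' = "br u v x" and ?y' = "br u v y" and ?z' = "br u v z"
  let ?a' = "part \<mu> \<nu> \<alpha> u d v f x a" and ?b' = "part \<mu> \<nu> \<beta> u d v f y b" and ?c' = "part \<mu> \<nu> \<gamma> u d v f z c"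
  note x' = bracket_graded[OF u(1) v(1) x(1)] part_in[OF u v x]
  note y' = bracket_graded[OF u(1) v(1) y(1)] part_in[OF u v y]
  note z' = bracket_graded[OF u(1) v(1) z(1)] part_in[OF u v z]
  have a: "D \<mu> \<nu> u v (scaleV (\<epsilon> \<alpha> (\<beta> + \<gamma>)) (\<theta> y z a)) =
      scaleV (\<epsilon> (?M + \<alpha>) (\<beta> + \<gamma>)) (\<theta> y z (D \<mu> \<nu> u v a))
      + scaleV (\<epsilon> ?M \<alpha>) (scaleV (\<epsilon> \<alpha> (?M + \<beta> + \<gamma>)) (\<theta> ?y' z a))
      + scaleV (\<epsilon> ?M (\<alpha> + \<beta>)) (scaleV (\<epsilon> \<alpha> (\<beta> + (?M + \<gamma>))) (\<theta> y ?z' a))"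
  proof -
    have "\<epsilon> ?M \<alpha> * \<epsilon> \<alpha> (?M + \<beta> + \<gamma>) = \<epsilon> \<alpha> (\<beta> + \<gamma>)"
      by (simp add: add.assoc eps_add_right[of \<alpha> ?M "\<beta> + \<gamma>", unfolded add.assoc] eps_cancel[of ?M, unfolded add.assoc])
    moreover have "\<epsilon> ?M (\<alpha> + \<beta>) * \<epsilon> \<alpha> (\<beta> + (?M + \<gamma>)) = \<epsilon> \<alpha> (\<beta> + \<gamma>) * \<epsilon> ?M \<beta>"
    proof -
      have "\<epsilon> M (\<alpha> + \<beta>) * \<epsilon> \<alpha> (\<beta> + (M + \<gamma>)) = (\<epsilon> M \<alpha> * \<epsilon> \<alpha> M) * (\<epsilon> \<alpha> (\<beta> + \<gamma>) * \<epsilon> M \<beta>)" for M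
        by (simp add: eps_add_right mult_ac)
      then show ?thesis by (simp add: eps_inverse)
    qed
    moreover have "\<epsilon> (?M + \<alpha>) (\<beta> + \<gamma>) = \<epsilon> \<alpha> (\<beta> + \<gamma>) * \<epsilon> ?M (\<beta> + \<gamma>)"
      by (simp add: eps_add_left[of ?M])
    ultimately show ?thesis
      by (simp only: D_scale D_theta[OF u(1) v(1) y(1) z(1)] V.scale_right_distrib V.scale_scale)
  qed
  have b: "D \<mu> \<nu> u v (scaleV (\<epsilon> \<beta> \<gamma>) (\<theta> x z b)) = scaleV (\<epsilon> \<beta> \<gamma>) (\<theta> ?x' z b)
      + scaleV (\<epsilon> ?M \<alpha>) (scaleV (\<epsilon> (?M + \<beta>) \<gamma>) (\<theta> x z (D \<mu> \<nu> u v b)))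
      + scaleV (\<epsilon> ?M (\<alpha> + \<beta>)) (scaleV (\<epsilon> \<beta> (?M + \<gamma>)) (\<theta> x ?z' b))"
  proof -
    have "\<epsilon> ?M (\<alpha> + \<beta>) * \<epsilon> \<beta> (?M + \<gamma>) = \<epsilon> \<beta> \<gamma> * \<epsilon> ?M \<alpha>"
      by (simp add: eps_add_right[of \<beta> ?M] eps_add_right[of ?M] eps_cancel)
    moreover have "\<epsilon> ?M \<alpha> * \<epsilon> (?M + \<beta>) \<gamma> = \<epsilon> \<beta> \<gamma> * \<epsilon> ?M (\<alpha> + \<gamma>)"
      by (simp add: eps_add_left[of ?M] eps_add_right[of ?M])
    ultimately show ?thesis
      by (simp only: D_scale D_theta[OF u(1) v(1) x(1) z(1)] V.scale_right_distrib V.scale_scale add_ac)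
  qed
  have d: "scaleV (\<epsilon> \<mu> (\<nu> + (\<alpha> + \<beta> + \<gamma>))) (\<theta> v (br x y z) d) =
      scaleV (\<epsilon> (?M + \<alpha>) (\<beta> + \<gamma>)) (\<theta> y z (scaleV (\<epsilon> \<mu> (\<nu> + \<alpha>)) (\<theta> v x d)))
      - scaleV (\<epsilon> ?M \<alpha>) (scaleV (\<epsilon> (?M + \<beta>) \<gamma>) (\<theta> x z (scaleV (\<epsilon> \<mu> (\<nu> + \<beta>)) (\<theta> v y d))))
      + scaleV (\<epsilon> ?M (\<alpha> + \<beta>)) (D \<alpha> \<beta> x y (scaleV (\<epsilon> \<mu> (\<nu> + \<gamma>)) (\<theta> v z d)))"
    by (simp add: theta_bracket_right[OF v(1) x(1) y(1) z(1)] theta_scale D_scale V.scale_right_distrib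
        V.scale_right_diff_distrib eps_add_left eps_add_right mult_ac)
  have f: "scaleV (\<epsilon> \<nu> (\<alpha> + \<beta> + \<gamma>)) (\<theta> u (br x y z) f) =
      scaleV (\<epsilon> (?M + \<alpha>) (\<beta> + \<gamma>)) (\<theta> y z (scaleV (\<epsilon> \<nu> \<alpha>) (\<theta> u x f)))
      - scaleV (\<epsilon> ?M \<alpha>) (scaleV (\<epsilon> (?M + \<beta>) \<gamma>) (\<theta> x z (scaleV (\<epsilon> \<nu> \<beta>) (\<theta> u y f))))
      + scaleV (\<epsilon> ?M (\<alpha> + \<beta>)) (D \<alpha> \<beta> x y (scaleV (\<epsilon> \<nu> \<gamma>) (\<theta> u z f)))"
    by (simp add: theta_bracket_right[OF u(1) x(1) y(1) z(1)] theta_scale D_scale V.scale_right_distrib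
        V.scale_right_diff_distrib eps_add_left eps_add_right mult_ac)
  note distrib = theta_additive(3) theta_diff D_add D_diff V.scale_right_distrib V.scale_right_diff_distrib
  have "part \<mu> \<nu> (\<alpha> + \<beta> + \<gamma>) u d v f (br x y z) (part \<alpha> \<beta> \<gamma> x a y b z c) =
      part (?M + \<alpha>) \<beta> \<gamma> ?x' ?a' y b z c
      + scaleV (\<epsilon> ?M \<alpha>) (part \<alpha> (?M + \<beta>) \<gamma> x a ?y' ?b' z c)
      + scaleV (\<epsilon> ?M (\<alpha> + \<beta>)) (part \<alpha> \<beta> (?M + \<gamma>) x a y b ?z' ?c')"
    unfolding part_def distrib a b d f D_D[OF u(1) v(1) x(1) y(1)]
    by (simp only: diff_conv_add_uminus minus_add_distrib minus_minus add_ac)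
  then show ?thesis
    unfolding hom[OF x y z] hom[OF u v x] hom[OF u v y] hom[OF u v z]
      hom[OF u v bracket_graded[OF x(1) y(1) z(1)] part_in[OF x y z]] hom[OF x' y z] hom[OF x y' z] hom[OF x y z']
      scaleL_Pair add_Pair bracket_derivation[OF u(1) v(1) x(1) y(1) z(1)] by simp
qed

theorem semidirect_color_triple: "color_triple \<epsilon> scaleL brL L"
  and semidirect_lie_color_triple_system: "lie_color_triple_system \<epsilon> scaleL L brL"
proof -
  interpret G: graded_vector_space scaleL L
    by (rule direct_sum_graded) unfold_locales
  have linear: "Vector_Spaces.linear scaleL scaleL (\<lambda>u. brL u v w)"
    "Vector_Spaces.linear scaleL scaleL (\<lambda>u. brL v u w)"
    "Vector_Spaces.linear scaleL scaleL (\<lambda>u. brL v w u)" for v w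
    unfolding semidirect_bracket_def
    by (rule G.linear_trilinear_extension; rule linear_semidirect_formula)+
  note lin = linear[unfolded Vector_Spaces.linear_iff]
  show triple: "color_triple \<epsilon> scaleL brL L"
  proof (rule color_triple.intro[OF bicharacter_axioms G.vector_space_axioms])
    show "triadditive brL" by unfold_locales (simp_all add: lin)
    show "color_triple_axioms \<epsilon> scaleL brL L"
    proof (rule color_triple_axioms.intro)
      fix x y z \<alpha> \<beta> \<gamma>
      assume "x \<in> L \<alpha>" "y \<in> L \<beta>" "z \<in> L \<gamma>"
      then obtain x1 a y1 b z1 c where xyz: "x = (x1, a)" "y = (y1, b)" "z = (z1, c)"
        and in_T: "x1 \<in> T \<alpha>" "a \<in> V \<alpha>" "y1 \<in> T \<beta>" "b \<in> V \<beta>" "z1 \<in> T \<gamma>" "c \<in> V \<gamma>"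
        by (auto simp: direct_sum_grading_def)
      show "brL x y z \<in> L (\<alpha> + \<beta> + \<gamma>)"
        unfolding xyz semidirect_bracket_homogeneous[OF in_T] direct_sum_grading_def
        using bracket_graded[OF in_T(1,3,5)] semidirect_in[OF in_T] by simp
      show "brL x y z = - scaleL (\<epsilon> \<alpha> \<beta>) (brL y x z)"
        unfolding xyz by (rule semidirect_skew[OF in_T])
      show "scaleL (\<epsilon> \<gamma> \<alpha>) (brL x y z) + scaleL (\<epsilon> \<alpha> \<beta>) (brL y z x) + scaleL (\<epsilon> \<beta> \<gamma>) (brL z x y) = 0"
        unfolding xyz by (rule semidirect_cyclic[OF in_T])
      fix u v \<mu> \<nu>
      assume "u \<in> L \<mu>" "v \<in> L \<nu>"
      then obtain u1 d v1 f where uv: "u = (u1, d)" "v = (v1, f)"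
        and in_T': "u1 \<in> T \<mu>" "d \<in> V \<mu>" "v1 \<in> T \<nu>" "f \<in> V \<nu>"
        by (auto simp: direct_sum_grading_def)
      show "brL u v (brL x y z) = brL (brL u v x) y z + scaleL (\<epsilon> (\<mu> + \<nu>) \<alpha>) (brL x (brL u v y) z)
          + scaleL (\<epsilon> (\<mu> + \<nu>) (\<alpha> + \<beta>)) (brL x y (brL u v z))"
        unfolding xyz uv by (rule semidirect_derivation[OF in_T' in_T])
    qed (simp_all add: lin G.subspace_grade)
  qed
  then show "lie_color_triple_system \<epsilon> scaleL L brL"
    by (rule color_triple.lie_color_triple_systemI) (rule G.graded_vector_space_axioms)
qed

end

section \<open>The \<open>p\<close>-map on the semidirect product\<close>

context color_representation
begin

interpretation G: graded_vector_space scaleL L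
  by (rule direct_sum_graded) unfold_locales

interpretation L: color_triple \<epsilon> scaleL brL L
  by (rule semidirect_color_triple)

text \<open>Both parts are taken inside T + V, so that the same bracket stands on both sides when
  the V-part is treated as a derivation along the T-part.\<close>

definition T_part :: "'t \<times> 'v \<Rightarrow> 't \<times> 'v" where
  "T_part u = (fst u, 0)"

definition V_part :: "'t \<times> 'v \<Rightarrow> 't \<times> 'v" where
  "V_part u = (0, snd u)"

lemma part_add: "T_part (u + v) = T_part u + T_part v" "V_part (u + v) = V_part u + V_part v"
  by (simp_all add: T_part_def V_part_def)

lemma part_zero: "T_part 0 = 0" "V_part 0 = 0"
  by (simp_all add: T_part_def V_part_def zero_prod_def)

lemma part_eqI: "T_part u = T_part v \<Longrightarrow> V_part u = V_part v \<Longrightarrow> u = v"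
  by (simp add: T_part_def V_part_def prod_eq_iff)

lemma zero_in: "0 \<in> T \<gamma>" "0 \<in> V \<gamma>"
  using subspace_0[OF subspace_grade] V.subspace_0[OF V.subspace_grade] by auto

lemma T_part_bracket: "T_part (brL u v w) = brL (T_part u) (T_part v) (T_part w)"
proof (rule G.graded_triadditive_eqI[where F = "\<lambda>u v w. T_part (brL u v w)" and G = "\<lambda>u v w. brL (T_part u) (T_part v) (T_part w)"])
  fix \<alpha> \<beta> \<gamma> u v w assume "u \<in> L \<alpha>" "v \<in> L \<beta>" "w \<in> L \<gamma>"
  then show "T_part (brL u v w) = brL (T_part u) (T_part v) (T_part w)"
    by (auto simp: direct_sum_grading_def T_part_def semidirect_bracket_homogeneous[of _ \<alpha> _ _ \<beta> _ _ \<gamma>] zero_in)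
qed (simp_all add: part_add L.add_1 L.add_2 L.add_3)

lemma V_part_bracket:
  "V_part (brL u v w) = brL (V_part u) (T_part v) (T_part w)
    + brL (T_part u) (V_part v) (T_part w) + brL (T_part u) (T_part v) (V_part w)"
proof (rule G.graded_triadditive_eqI[where F = "\<lambda>u v w. V_part (brL u v w)" and G = "\<lambda>u v w. brL (V_part u) (T_part v) (T_part w)
    + brL (T_part u) (V_part v) (T_part w) + brL (T_part u) (T_part v) (V_part w)"])
  fix \<alpha> \<beta> \<gamma> u v w assume "u \<in> L \<alpha>" "v \<in> L \<beta>" "w \<in> L \<gamma>"
  then show "V_part (brL u v w) = brL (V_part u) (T_part v) (T_part w)
    + brL (T_part u) (V_part v) (T_part w) + brL (T_part u) (T_part v) (V_part w)"
    by (auto simp: direct_sum_grading_def T_part_def V_part_def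
        semidirect_bracket_homogeneous[of _ \<alpha> _ _ \<beta> _ _ \<gamma>] zero_in)
qed (simp_all add: part_add L.add_1 L.add_2 L.add_3 add_ac)

lemma fst_bracket: "fst (brL u v w) = br (fst u) (fst v) (fst w)"
proof (rule G.graded_triadditive_eqI[where F = "\<lambda>u v w. fst (brL u v w)" and G = "\<lambda>u v w. br (fst u) (fst v) (fst w)"])
  fix \<alpha> \<beta> \<gamma> u v w assume "u \<in> L \<alpha>" "v \<in> L \<beta>" "w \<in> L \<gamma>"
  then show "fst (brL u v w) = br (fst u) (fst v) (fst w)"
    by (auto simp: direct_sum_grading_def semidirect_bracket_homogeneous[of _ \<alpha> _ _ \<beta> _ _ \<gamma>])
qed (simp_all add: add_1 add_2 add_3 L.add_1 L.add_2 L.add_3)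

lemma theta_power_in:
  assumes "y \<in> T \<gamma>" "a \<in> V \<delta>"
  shows "(\<theta> y y ^^ k) a \<in> V (\<delta> + nmult (2 * k) \<gamma>)"
proof (induction k)
  case (Suc k)
  have "\<delta> + nmult (2 * k) \<gamma> + \<gamma> + \<gamma> = \<delta> + nmult (2 * Suc k) \<gamma>"
    by (simp add: nmult_Suc add.assoc)
  with rep_1[OF assms(1,1) Suc] show ?case by simp
qed (use assms in simp)

lemma theta_power_scale: "(\<theta> y y ^^ k) (scaleV c a) = scaleV c ((\<theta> y y ^^ k) a)"
  by (induction k) (simp_all add: theta_scale)

text \<open>Each pair of factors y amounts to one application of \<open>\<theta> y y\<close>; the
  degree gained on the way is a multiple of \<open>\<gamma>\<close> and contributes the factor 1.
  For \<open>\<delta> = \<gamma>\<close> and 2k = p - 1 this is the V-part of the p-map.\<close>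

lemma iter_bracket_V_part:
  assumes y: "y \<in> T \<gamma>" and "\<gamma> \<in> G_plus \<epsilon>" and a: "a \<in> V \<delta>"
  shows "iter_bracket brL ((0, a) # replicate (2 * k) (y, 0)) =
    (0, scaleV (\<epsilon> \<delta> \<gamma> ^ (2 * k)) ((\<theta> y y ^^ k) a))"
proof (induction k)
  case 0
  then show ?case by simp
next
  case (Suc k)
  have "\<epsilon> \<gamma> \<gamma> = 1" using assms(2) by (simp add: G_plus_def)
  have "scaleV (\<epsilon> \<delta> \<gamma> ^ (2 * k)) ((\<theta> y y ^^ k) a) \<in> V (\<delta> + nmult (2 * k) \<gamma>)"
    using theta_power_in[OF y a] by (rule V.subspace_scale[OF V.subspace_grade])
  then show ?case
    unfolding iter_bracket_replicate_Suc Suc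
    by (simp add: semidirect_bracket_homogeneous[OF zero_in(1) _ y zero_in(2) y zero_in(2)] theta_scale
        eps_add_left eps_add_right eps_nmult_left \<open>\<epsilon> \<gamma> \<gamma> = 1\<close> power_add power2_eq_square mult_ac)
qed

end

section \<open>The p-map and its axioms\<close>

context restricted_color_representation
begin

interpretation G: graded_vector_space scaleL L
  by (rule direct_sum_graded) unfold_locales

interpretation L: color_triple \<epsilon> scaleL brL L
  by (rule semidirect_color_triple)

definition pmL :: "'g \<Rightarrow> 't \<times> 'v \<Rightarrow> 't \<times> 'v" where
  "pmL \<gamma> w = (pm \<gamma> (fst w), (\<theta> (fst w) (fst w) ^^ ((p - 1) div 2)) (snd w))"

context
  fixes m
  assumes char: "CHAR('k) = p" and prime: "prime p" and m: "p = Suc (2 * m)"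
begin

lemma half_pred: "(p - 1) div 2 = m"
  using m by simp

lemma pmL_Pair: "pmL \<gamma> (x, a) = (pm \<gamma> x, (\<theta> x x ^^ m) a)"
  unfolding pmL_def half_pred by simp

lemma pmL_degree:
  assumes "\<gamma> \<in> G_plus \<epsilon>" "w \<in> L \<gamma>"
  shows "pmL \<gamma> w \<in> L (nmult p \<gamma>)"
proof -
  have "nmult p \<gamma> = \<gamma> + nmult (2 * m) \<gamma>" by (simp add: m nmult_Suc add.commute)
  with assms p_map_degree[OF assms(1)] theta_power_in[of "fst w" \<gamma> "snd w" \<gamma> m] show ?thesis
    by (auto simp: direct_sum_grading_def pmL_Pair)
qed

lemma pmL_scale:
  assumes "\<gamma> \<in> G_plus \<epsilon>" "w \<in> L \<gamma>"
  shows "pmL \<gamma> (scaleL c w) = scaleL (c ^ p) (pmL \<gamma> w)"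
proof -
  have "(\<theta> (scaleT c x) (scaleT c x) ^^ k) a = scaleV (c ^ (2 * k)) ((\<theta> x x ^^ k) a)" for k x a
    by (induction k) (simp_all add: theta_scale mult_ac)
  moreover have "c ^ p = c ^ (2 * m) * c" by (subst m) simp
  ultimately show ?thesis
    using assms p_map_scale[OF assms(1)]
    by (auto simp: direct_sum_grading_def pmL_Pair scaleL_Pair theta_power_scale mult_ac)
qed

text \<open>The contribution of V in the first slot: both sides are computed through
  \<open>\<theta>\<close>, and \<open>restricted_1\<close> makes them agree.\<close>

lemma pmL_bracket_1:
  assumes \<gamma>: "\<gamma> \<in> G_plus \<epsilon>" and y: "y \<in> T \<gamma>" and a: "a \<in> V \<alpha>" and z: "z \<in> T \<zeta>"
  shows "brL (iter_bracket brL ((0, a) # replicate (2 * m) (y, 0))) (y, 0) (z, 0) = brL (0, a) (pm \<gamma> y, 0) (z, 0)"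
proof -
  have "\<epsilon> \<gamma> \<gamma> = 1" using \<gamma> by (simp add: G_plus_def)
  have in_V: "scaleV c ((\<theta> y y ^^ m) a) \<in> V (\<alpha> + nmult (2 * m) \<gamma>)" for c
    using theta_power_in[OF y a] by (rule V.subspace_scale[OF V.subspace_grade])
  show ?thesis
    unfolding iter_bracket_V_part[OF y \<gamma> a]
      semidirect_bracket_homogeneous[OF zero_in(1) in_V y zero_in(2) z zero_in(2)]
      semidirect_bracket_homogeneous[OF zero_in(1) a p_map_degree[OF \<gamma> y] zero_in(2) z zero_in(2)]
    by (simp add: restricted_1[OF \<gamma> y z] theta_scale m eps_add_left eps_add_right eps_nmult_left
        eps_nmult_right \<open>\<epsilon> \<gamma> \<gamma> = 1\<close> mult_ac)
qed

text \<open>The contribution of V in the last slot: \<open>bracket_power_flip\<close> and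
  \<open>bracket_flip\<close> bring c to the front on the two sides. Of the resulting words, the one
  with x next to c is settled by \<open>restricted_2\<close>, the one with x at the end by
  \<open>pmL_bracket_1\<close>.\<close>

lemma pmL_bracket_3:
  assumes \<gamma>: "\<gamma> \<in> G_plus \<epsilon>" and y: "y \<in> T \<gamma>" and x: "x \<in> T \<alpha>" and c: "c \<in> V \<zeta>"
  shows "brL (iter_bracket brL ((x, 0) # replicate (2 * m) (y, 0))) (y, 0) (0, c) = brL (x, 0) (pm \<gamma> y, 0) (0, c)"
proof -
  have "\<epsilon> \<gamma> \<gamma> = 1" using \<gamma> by (simp add: G_plus_def)
  have in_L: "(x, 0) \<in> L \<alpha>" "(y, 0) \<in> L \<gamma>" "(0, c) \<in> L \<zeta>" "(pm \<gamma> y, 0) \<in> L (nmult p \<gamma>)"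
    using x y c p_map_degree[OF \<gamma> y] zero_in by (auto simp: direct_sum_grading_def)
  interpret color_triple_power \<epsilon> scaleL brL L \<alpha> \<gamma> "(x, 0)" "(y, 0)" "\<epsilon> \<alpha> \<gamma>"
    by (rule color_triple_power.intro[OF L.color_triple_axioms])
      (rule color_triple_power_axioms.intro[OF in_L(1,2) \<gamma> refl])
  have "iter_bracket brL ((0, c) # (x, 0) # replicate p (y, 0)) = brL (0, c) (x, 0) (pm \<gamma> y, 0)"
  proof -
    have c': "scaleV (\<epsilon> \<zeta> (\<alpha> + \<gamma>)) (\<theta> x y c) \<in> V (\<zeta> + \<alpha> + \<gamma>)"
      using rep_1[OF x y c] by (rule V.subspace_scale[OF V.subspace_grade])
    have "brL (0, c) (x, 0) (y, 0) = (0, scaleV (\<epsilon> \<zeta> (\<alpha> + \<gamma>)) (\<theta> x y c))"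
      by (simp add: semidirect_bracket_homogeneous[OF zero_in(1) c x zero_in(2) y zero_in(2)])
    then have "iter_bracket brL ((0, c) # (x, 0) # replicate p (y, 0)) =
        (0, scaleV (\<epsilon> (\<zeta> + \<alpha> + \<gamma>) \<gamma> ^ (2 * m)) ((\<theta> y y ^^ m) (scaleV (\<epsilon> \<zeta> (\<alpha> + \<gamma>)) (\<theta> x y c))))"
      by (simp add: m iter_bracket_V_part[OF y \<gamma> c'])
    also have "\<dots> = brL (0, c) (x, 0) (pm \<gamma> y, 0)"
      unfolding semidirect_bracket_homogeneous[OF zero_in(1) c x zero_in(2) p_map_degree[OF \<gamma> y] zero_in(2)]
      by (simp add: restricted_2[OF \<gamma> x y] theta_power_scale m eps_add_left eps_add_right eps_nmult_right
          \<open>\<epsilon> \<gamma> \<gamma> = 1\<close> power_mult_distrib mult_ac)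
    finally show ?thesis .
  qed
  moreover have "iter_bracket brL ((0, c) # replicate p (y, 0) @ [(x, 0)]) = brL (0, c) (pm \<gamma> y, 0) (x, 0)"
  proof -
    have list: "(0, c) # replicate p (y, 0) @ [(x, 0)] = ((0, c) # replicate (2 * m) (y, 0)) @ [(y, 0), (x, 0)]"
      unfolding m replicate_Suc_snoc by simp
    show ?thesis
      unfolding list by (subst iter_bracket_snoc2) (simp_all add: pmL_bracket_1[OF \<gamma> y c x])
  qed
  ultimately show ?thesis
    using bracket_power_flip[OF prime char _ in_L(3)] L.bracket_flip[OF in_L(1,4,3)]
    by (simp add: m eps_nmult_right)
qed

text \<open>By additivity u and z may be taken homogeneous. The T-part is the axiom for T; the
  V-part has three contributions, according to whether its entry from V belongs to u, w or
  z.\<close>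

lemma pmL_bracket:
  assumes \<gamma>: "\<gamma> \<in> G_plus \<epsilon>" and w: "w \<in> L \<gamma>"
  shows "brL u (pmL \<gamma> w) z = iter_bracket brL (u # replicate p w @ [z])"
proof -
  let ?I = "\<lambda>u. iter_bracket brL (u # replicate (2 * m) w)"
  have I_add: "?I (u + v) = ?I u + ?I v" for u v
    by (rule L.iter_bracket_add) simp
  have "brL u (pmL \<gamma> w) z = brL (?I u) w z"
  proof (induction u rule: G.homogeneous_induct)
    case u: (homogeneous \<alpha> u)
    show ?case
    proof (induction z rule: G.homogeneous_induct)
      case z: (homogeneous \<zeta> z)
      obtain x a y b t c where uwz: "u = (x, a)" "w = (y, b)" "z = (t, c)"
        by (cases u; cases w; cases z) auto
      with u w z have x: "x \<in> T \<alpha>" "a \<in> V \<alpha>" and y: "y \<in> T \<gamma>" "b \<in> V \<gamma>" and t: "t \<in> T \<zeta>" "c \<in> V \<zeta>"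
        by (auto simp: direct_sum_grading_def)
      have in_L: "(x, 0) \<in> L \<alpha>" "(y, 0) \<in> L \<gamma>" "(0, b) \<in> L \<gamma>" "(t, 0) \<in> L \<zeta>"
        using x y t zero_in by (auto simp: direct_sum_grading_def)
      interpret color_triple_power \<epsilon> scaleL brL L \<alpha> \<gamma> "(x, 0)" "(y, 0)" "\<epsilon> \<alpha> \<gamma>"
        by (rule color_triple_power.intro[OF L.color_triple_axioms])
          (rule color_triple_power_axioms.intro[OF in_L(1,2) \<gamma> refl])
      have "\<epsilon> \<gamma> \<gamma> = 1" using \<gamma> by (simp add: G_plus_def)
      let ?Y = "replicate (2 * m) (y, 0)"
      have T_I: "T_part (?I u) = iter_bracket brL ((x, 0) # ?Y)"
        using iter_bracket_map_hom[of T_part brL brL "u # replicate (2 * m) w"]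
        by (simp add: T_part_bracket) (simp add: T_part_def uwz)
      \<comment> \<open>The V-part of the p-map is itself the product (b, y, ..., y), the form in
        which \<open>sum_insertions_prime\<close> yields it.\<close>
      have b': "iter_bracket brL ((0, b) # ?Y) = V_part (pmL \<gamma> w)"
        by (simp add: uwz V_part_def pmL_Pair iter_bracket_V_part[OF y(1) \<gamma> y(2)] \<open>\<epsilon> \<gamma> \<gamma> = 1\<close>)
      have parts: "T_part u = (x, 0)" "V_part u = (0, a)" "T_part w = (y, 0)" "V_part w = (0, b)"
        "T_part z = (t, 0)" "V_part z = (0, c)" "T_part (pmL \<gamma> w) = (pm \<gamma> y, 0)"
        by (simp_all add: T_part_def V_part_def uwz pmL_Pair)
      define S where "S i = iter_bracket brL ((x, 0) # replicate i (y, 0) @ (0, b) # replicate (2 * m - 1 - i) (y, 0))" for i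
      have V_I: "V_part (?I u) = iter_bracket brL ((0, a) # ?Y) + (\<Sum>i<2 * m. S i)"
        using iter_bracket_leibniz[of brL T_part brL V_part u m w, OF L.triadditive_axioms T_part_bracket V_part_bracket]
        by (simp add: parts S_def)
      \<comment> \<open>The 2m positions inside \<open>?I u\<close> and the final factor w together
        are the p positions summed over in \<open>sum_insertions_prime\<close>.\<close>
      have "brL (\<Sum>i<2 * m. S i) (y, 0) (t, 0) + brL (iter_bracket brL ((x, 0) # ?Y)) (0, b) (t, 0) =
          (\<Sum>i<p. iter_bracket brL ((x, 0) # replicate i (y, 0) @ (0, b) # replicate (p - 1 - i) (y, 0) @ [(t, 0)]))"
      proof -
        have step: "brL (S i) (y, 0) (t, 0) =
            iter_bracket brL ((x, 0) # replicate i (y, 0) @ (0, b) # replicate (p - 1 - i) (y, 0) @ [(t, 0)])"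
          if "i < 2 * m" for i
        proof -
          have "p - 1 - i = Suc (2 * m - 1 - i)" using that m by simp
          then have "(x, 0) # replicate i (y, 0) @ (0, b) # replicate (p - 1 - i) (y, 0) @ [(t, 0)] =
            ((x, 0) # replicate i (y, 0) @ (0, b) # replicate (2 * m - 1 - i) (y, 0)) @ [(y, 0), (t, 0)]"
            by (simp only: replicate_Suc_snoc append_Cons append_assoc)
          moreover have "odd (length ((x, 0) # replicate i (y, 0) @ (0, b) # replicate (2 * m - 1 - i) (y, 0)))"
            using that by simp
          ultimately show ?thesis
            unfolding S_def by (metis iter_bracket_snoc2)
        qed
        have "(\<Sum>i<2 * m. brL (S i) (y, 0) (t, 0)) = (\<Sum>i<2 * m.
            iter_bracket brL ((x, 0) # replicate i (y, 0) @ (0, b) # replicate (p - 1 - i) (y, 0) @ [(t, 0)]))"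
          by (intro sum.cong refl step) simp
        moreover have "brL (iter_bracket brL ((x, 0) # ?Y)) (0, b) (t, 0) =
            iter_bracket brL ((x, 0) # ?Y @ (0, b) # replicate (p - 1 - 2 * m) (y, 0) @ [(t, 0)])"
          using iter_bracket_snoc2[of "(x, 0) # ?Y" brL "(0, b)" "(t, 0)"] m by simp
        moreover have "(\<Sum>i<p. R i) = (\<Sum>i<2 * m. R i) + R (2 * m)" for R :: "nat \<Rightarrow> 't \<times> 'v"
          by (simp add: m)
        ultimately show ?thesis
          unfolding L.sum_1 by (simp only:)
      qed
      also have "\<dots> = brL (x, 0) (V_part (pmL \<gamma> w)) (t, 0)"
        using sum_insertions_prime[OF prime char _ in_L(3,4)] b' m by simp
      finally have middle: "brL (\<Sum>i<2 * m. S i) (y, 0) (t, 0) + brL (iter_bracket brL ((x, 0) # ?Y)) (0, b) (t, 0) =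
        brL (x, 0) (V_part (pmL \<gamma> w)) (t, 0)" .
      show ?case
      proof (rule part_eqI)
        have "fst (?I u) = iter_bracket br (x # replicate (2 * m) y)"
          using iter_bracket_map_hom[of fst brL br "u # replicate (2 * m) w"] by (simp add: fst_bracket uwz)
        moreover have "br x (pm \<gamma> y) t = br (iter_bracket br (x # replicate (2 * m) y)) y t"
        proof -
          have "x # replicate p y @ [t] = (x # replicate (2 * m) y) @ [y, t]"
            unfolding m replicate_Suc_snoc by simp
          then show ?thesis
            using p_map_bracket[OF \<gamma> y(1), of x t] iter_bracket_snoc2[of "x # replicate (2 * m) y" br y t] by simp
        qed
        ultimately show "T_part (brL u (pmL \<gamma> w) z) = T_part (brL (?I u) w z)"
          by (simp add: T_part_def fst_bracket uwz pmL_Pair)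
        show "V_part (brL u (pmL \<gamma> w) z) = V_part (brL (?I u) w z)"
          unfolding V_part_bracket parts V_I T_I L.add_1 pmL_bracket_1[OF \<gamma> y(1) x(2) t(1)]
            pmL_bracket_3[OF \<gamma> y(1) x(1) t(2)]
          by (simp add: add.assoc flip: middle)
      qed
    qed (simp add: L.add_3)
  qed (simp add: L.add_1 I_add)
  moreover have "u # replicate p w @ [z] = (u # replicate (2 * m) w) @ [w, z]"
    unfolding m replicate_Suc_snoc by simp
  ultimately show ?thesis
    using iter_bracket_snoc2[of "u # replicate (2 * m) w" brL w z] by simp
qed

section \<open>Additivity of the p-map\<close>

lemma fst_s_coeff: "fst (s_coeff p scaleL brL i w w') = s_coeff p scaleT br i (fst w) (fst w')"
proof -
  \<comment> \<open>As \<open>fst\<close> respects brackets, the polynomial defining the s_i of T +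
    V projects to the one of T.\<close>
  have "map_poly fst (poly_bracket brL f g h) = poly_bracket br (map_poly fst f) (map_poly fst g) (map_poly fst h)"
    for f g h
    by (rule map_poly_bracket_hom[OF L.triadditive_axioms triadditive_axioms])
      (simp_all add: fst_bracket)
  then have "map_poly fst (iter_bracket (poly_bracket brL) ([:w:] # replicate (p - 1) [:w', w:])) =
      iter_bracket (poly_bracket br) (map (map_poly fst) ([:w:] # replicate (p - 1) [:w', w:]))"
    by (rule iter_bracket_map_hom[where f = "map_poly fst" and br = "poly_bracket brL" and br' = "poly_bracket br"])
      (simp add: m)
  then have "coeff (map_poly fst (iter_bracket (poly_bracket brL) ([:w:] # replicate (p - 1) [:w', w:]))) j =
      coeff (iter_bracket (poly_bracket br) ([:fst w:] # replicate (p - 1) [:fst w', fst w:])) j" for j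
    by (simp add: map_poly_pCons)
  then have "fst (coeff (iter_bracket (poly_bracket brL) ([:w:] # replicate (p - 1) [:w', w:])) j) =
      coeff (iter_bracket (poly_bracket br) ([:fst w:] # replicate (p - 1) [:fst w', fst w:])) j" for j
    by (simp add: coeff_map_poly)
  moreover have "fst (scaleL c u) = scaleT c (fst u)" for c u
    by (cases u) (simp add: scaleL_Pair)
  ultimately show ?thesis by (simp add: s_coeff_def)
qed

text \<open>Put Q = (Z a + b, Z x + y, ..., Z x + y). Its derivative is the V-part of the sum of the
  i s_i Z^(i - 1), so for 0 < i < p the V-part of s_i is coefficient i of Q. These coefficients add
  up to Q(1) minus the coefficients at 0 and p, which gives the three powers of
  \<open>\<theta>\<close>.\<close>

lemma snd_sum_s_coeff:
  assumes \<gamma>: "\<gamma> \<in> G_plus \<epsilon>" and x: "x \<in> T \<gamma>" "a \<in> V \<gamma>" and y: "y \<in> T \<gamma>" "b \<in> V \<gamma>"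
  shows "(\<Sum>i = 1..p - 1. snd (s_coeff p scaleL brL i (x, a) (y, b))) =
    (\<theta> (x + y) (x + y) ^^ m) (a + b) - (\<theta> x x ^^ m) a - (\<theta> y y ^^ m) b"
proof -
  let ?P = "poly_bracket brL"
  define B Y where "B = [:(0 :: 't, b), (0, a):]" and "Y = [:(y, 0), (x, 0 :: 'v):]"
  define Q where "Q = iter_bracket ?P (B # replicate (2 * m) Y)"
  have "\<epsilon> \<gamma> \<gamma> = 1" using \<gamma> by (simp add: G_plus_def)
  have power_iter: "iter_bracket brL ((0, c) # replicate (2 * m) (z, 0)) = (0, (\<theta> z z ^^ m) c)"
    if "z \<in> T \<gamma>" "c \<in> V \<gamma>" for z c
    using iter_bracket_V_part[OF that(1) \<gamma> that(2)] \<open>\<epsilon> \<gamma> \<gamma> = 1\<close> by simp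
  have deriv: "poly_deriv scaleL Y = [:(x, 0):]" "poly_deriv scaleL B = [:(0, a):]"
    unfolding B_def Y_def
    by (rule poly_eqI; simp add: vector_space.coeff_poly_deriv[OF vector_space_L] coeff_pCons split: nat.split)+
  text \<open>The \<open>V\<close>-part of the polynomial defining the \<open>s\<^sub>i\<close> is the derivative of \<open>Q\<close>.\<close>
  have deriv_Q: "map_poly V_part (iter_bracket ?P ([:(x, a):] # replicate (2 * m) [:(y, b), (x, a):])) = poly_deriv scaleL Q"
  proof -
    have V_hom: "map_poly V_part (?P u v w) = ?P (map_poly V_part u) (map_poly T_part v) (map_poly T_part w)
      + ?P (map_poly T_part u) (map_poly V_part v) (map_poly T_part w)
      + ?P (map_poly T_part u) (map_poly T_part v) (map_poly V_part w)" for u v w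
      by (rule map_poly_bracket_derivation[where g = T_part and h = V_part, OF L.triadditive_axioms L.triadditive_axioms part_add V_part_bracket])
    have T_hom: "map_poly T_part (?P u v w) = ?P (map_poly T_part u) (map_poly T_part v) (map_poly T_part w)" for u v w
      by (rule map_poly_bracket_hom[where g = T_part, OF L.triadditive_axioms L.triadditive_axioms part_add(1) T_part_bracket])
    have parts: "map_poly T_part [:(x, a):] = [:(x, 0):]" "map_poly V_part [:(x, a):] = [:(0, a):]"
      "map_poly T_part [:(y, b), (x, a):] = Y" "map_poly V_part [:(y, b), (x, a):] = B"
      by (simp_all add: map_poly_pCons part_zero B_def Y_def) (simp_all add: T_part_def V_part_def)
    interpret Q: color_triple_power \<epsilon> "\<lambda>c. map_poly (scaleL c)" ?P "poly_grade L" \<gamma> \<gamma> "[:(x, 0):]" Y 1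
      by (rule color_triple_power.intro[OF L.poly_color_triple], rule color_triple_power_axioms.intro)
        (use x y zero_in \<gamma> \<open>\<epsilon> \<gamma> \<gamma> = 1\<close> in \<open>auto simp: poly_grade_def direct_sum_grading_def Y_def coeff_pCons
          zero_prod_def split: nat.split\<close>)
    have "B \<in> poly_grade L \<gamma>"
      using x y zero_in by (auto simp: poly_grade_def direct_sum_grading_def B_def coeff_pCons zero_prod_def split: nat.split)
    \<comment> \<open>The Leibniz rules for \<open>V_part\<close> and for d/dZ differ only by
      exchanging \<open>B\<close> with (x, 0), the derivative of \<open>Y\<close>. Both have degree
      \<open>\<gamma>\<close>, so the exchange is the case e = 1 over polynomials.\<close>
    then have "(\<Sum>i<p - 1. iter_bracket ?P ([:(x, 0):] # replicate i Y @ B # replicate (p - 2 - i) Y)) =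
      (\<Sum>i<p - 1. iter_bracket ?P (B # replicate i Y @ [:(x, 0):] # replicate (p - 2 - i) Y))"
      using m by (intro Q.sum_insertions_pred_prime[OF prime char]) auto
    moreover have "p - 1 = 2 * m" "p - 2 = 2 * m - 1" using m by simp_all
    ultimately have swap: "(\<Sum>i<2 * m. iter_bracket ?P ([:(x, 0):] # replicate i Y @ B # replicate (2 * m - 1 - i) Y)) =
      (\<Sum>i<2 * m. iter_bracket ?P (B # replicate i Y @ [:(x, 0):] # replicate (2 * m - 1 - i) Y))"
      by simp
    have "poly_deriv scaleL (?P f g h) = ?P (poly_deriv scaleL f) g h + ?P f (poly_deriv scaleL g) h
        + ?P f g (poly_deriv scaleL h)" for f g h
      by (rule vector_space.poly_deriv_poly_bracket[where br = brL and scale = scaleL, OF vector_space_L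
            L.triadditive_axioms L.bracket_scale_1 L.bracket_scale_2 L.bracket_scale_3])
    from iter_bracket_leibniz[where g = "\<lambda>f. f" and h = "poly_deriv scaleL" and br = ?P and br' = ?P,
        OF L.poly_bracket_triadditive refl this]
    have "poly_deriv scaleL Q = iter_bracket ?P (poly_deriv scaleL B # replicate (2 * m) Y) +
      (\<Sum>i<2 * m. iter_bracket ?P (B # replicate i Y @ poly_deriv scaleL Y # replicate (2 * m - 1 - i) Y))"
      unfolding Q_def .
    moreover note iter_bracket_leibniz[where g = "map_poly T_part" and h = "map_poly V_part" and br = ?P and br' = ?P,
        OF L.poly_bracket_triadditive T_hom V_hom, of "[:(x, a):]" m "[:(y, b), (x, a):]"]
    ultimately show ?thesis
      unfolding parts deriv swap by simp
  qed
  have s: "snd (s_coeff p scaleL brL i (x, a) (y, b)) = snd (coeff Q i)" if "i \<in> {1..p - 1}" for i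
  proof -
    let ?F = "iter_bracket ?P ([:(x, a):] # replicate (2 * m) [:(y, b), (x, a):])"
    \<comment> \<open>The division by i in \<open>s_coeff\<close> undoes the factor i of the
      derivative.\<close>
    have "(of_nat i :: 'k) \<noteq> 0"
      using that by (auto simp: of_nat_eq_0_iff_char_dvd char dest: dvd_imp_le)
    have "V_part (coeff ?F (i - 1)) = scaleL (of_nat i) (coeff Q i)"
      using that arg_cong[OF deriv_Q, of "\<lambda>f. coeff f (i - 1)"]
      by (simp add: coeff_map_poly vector_space.coeff_poly_deriv[OF vector_space_L] V_part_def zero_prod_def)
    then have "snd (coeff ?F (i - 1)) = scaleV (of_nat i) (snd (coeff Q i))"
      by (cases "coeff Q i") (simp add: V_part_def scaleL_Pair)
    moreover have "snd (scaleL c u) = scaleV c (snd u)" for c u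
      by (cases u) (simp add: scaleL_Pair)
    moreover have "p - 1 = 2 * m" using m by simp
    ultimately show ?thesis
      using \<open>of_nat i \<noteq> 0\<close> by (simp add: s_coeff_def)
  qed
  have degree: "degree B \<le> 1" "degree Y \<le> 1"
    by (simp_all add: B_def Y_def)
  \<comment> \<open>Evaluation at Z = 1 (\<open>total\<close>), at Z = 0 (\<open>low\<close>) and
    the top coefficient (\<open>high\<close>) each turn Q into a left-normed product in T +
    V.\<close>
  have "coeff_sum Q = iter_bracket brL (coeff_sum B # replicate (2 * m) (coeff_sum Y))"
    unfolding Q_def by (subst iter_bracket_map_hom[where f = coeff_sum and br = ?P and br' = brL, OF L.coeff_sum_poly_bracket]) simp_all
  also have "coeff_sum B = (0, a + b)"
    by (simp add: coeff_sum_bounded[OF degree(1)]) (simp add: B_def add.commute)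
  also have "coeff_sum Y = (x + y, 0)"
    by (simp add: coeff_sum_bounded[OF degree(2)]) (simp add: Y_def add.commute)
  finally have total: "coeff_sum Q = (0, (\<theta> (x + y) (x + y) ^^ m) (a + b))"
    using x y by (simp add: power_iter subspace_add[OF subspace_grade] V.subspace_add[OF V.subspace_grade])
  have low: "coeff Q 0 = (0, (\<theta> y y ^^ m) b)"
    unfolding Q_def
    by (subst iter_bracket_map_hom[where f = "\<lambda>f. coeff f 0" and br = ?P and br' = brL, OF L.coeff_0_poly_bracket])
      (simp_all add: B_def Y_def power_iter y)
  have high: "degree Q \<le> p" "coeff Q p = (0, (\<theta> x x ^^ m) a)"
    using L.iter_poly_bracket_top[OF degree, of m] by (simp_all add: Q_def m B_def Y_def power_iter x)
  have "coeff_sum Q = (\<Sum>i\<le>p. coeff Q i)"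
    by (rule coeff_sum_bounded[OF high(1)])
  also have "{..p} = {0, p} \<union> {1..p - 1}"
    using m by auto
  also have "(\<Sum>i\<in>\<dots>. coeff Q i) = coeff Q 0 + coeff Q p + (\<Sum>i = 1..p - 1. coeff Q i)"
    using m by (subst sum.union_disjoint) auto
  finally have "snd (coeff_sum Q) = snd (coeff Q 0) + snd (coeff Q p) + (\<Sum>i = 1..p - 1. snd (coeff Q i))"
    by (simp add: snd_sum)
  then show ?thesis
    unfolding total low high by (simp add: s algebra_simps)
qed

lemma pmL_add:
  assumes \<gamma>: "\<gamma> \<in> G_plus \<epsilon>" and w: "w \<in> L \<gamma>" "w' \<in> L \<gamma>"
  shows "pmL \<gamma> (w + w') = pmL \<gamma> w + pmL \<gamma> w' + (\<Sum>i = 1..p - 1. s_coeff p scaleL brL i w w')"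
proof -
  obtain x a y b where ww': "w = (x, a)" "w' = (y, b)" by (cases w; cases w') auto
  with w have x: "x \<in> T \<gamma>" "a \<in> V \<gamma>" and y: "y \<in> T \<gamma>" "b \<in> V \<gamma>"
    by (auto simp: direct_sum_grading_def)
  show ?thesis
    unfolding ww'
    by (simp add: prod_eq_iff pmL_Pair fst_sum snd_sum fst_s_coeff snd_sum_s_coeff[OF \<gamma> x y, simplified]
        p_map_add[OF \<gamma> x(1) y(1)])
qed

lemma restricted_semidirect:
  "restricted_lie_color_triple_system p \<epsilon> scaleL L brL pmL"
  by (rule restricted_lie_color_triple_system.intro[OF semidirect_lie_color_triple_system],
      rule restricted_lie_color_triple_system_axioms.intro)
    (fact pmL_degree | fact pmL_scale | fact pmL_add | fact pmL_bracket)+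

end

end

theorem theorem4p19:
  fixes p :: nat
    and \<epsilon> :: "'g::ab_group_add \<Rightarrow> 'g \<Rightarrow> 'k::field"
    and scaleT :: "'k \<Rightarrow> 't::ab_group_add \<Rightarrow> 't"
    and T :: "'g \<Rightarrow> 't set"
    and br :: "'t \<Rightarrow> 't \<Rightarrow> 't \<Rightarrow> 't"
    and pm :: "'g \<Rightarrow> 't \<Rightarrow> 't"
    and scaleV :: "'k \<Rightarrow> 'v::ab_group_add \<Rightarrow> 'v"
    and V :: "'g \<Rightarrow> 'v set"
    and \<theta> :: "'t \<Rightarrow> 't \<Rightarrow> 'v \<Rightarrow> 'v"
    and I :: "'g \<Rightarrow> 'i set"
    and x :: "'g \<Rightarrow> 'i \<Rightarrow> 't"
    and v :: "'g \<Rightarrow> 'i \<Rightarrow> 'v"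
  assumes "CHAR('k) = p" and "p > 3"
    and "restricted_lie_color_triple_system p \<epsilon> scaleT T br pm"
    and "restricted_color_representation p \<epsilon> scaleT T br pm scaleV V \<theta>"
    and "\<And>\<gamma>. \<gamma> \<in> G_plus \<epsilon> \<Longrightarrow>
      family_basis (module_prod.scale scaleT scaleV) (direct_sum_grading T V \<gamma>)
        (I \<gamma>) (\<lambda>i. (x \<gamma> i, v \<gamma> i))"
  shows "\<exists>pm'.
    restricted_lie_color_triple_system p \<epsilon> (module_prod.scale scaleT scaleV)
      (direct_sum_grading T V) (semidirect_bracket \<epsilon> T br scaleV V \<theta>) pm' \<and>
    (\<forall>\<gamma>\<in>G_plus \<epsilon>. \<forall>i\<in>I \<gamma>.
      pm' \<gamma> (x \<gamma> i, v \<gamma> i) =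
        (pm \<gamma> (x \<gamma> i), (\<theta> (x \<gamma> i) (x \<gamma> i) ^^ ((p - 1) div 2)) (v \<gamma> i)))"
proof -
  interpret R: restricted_color_representation p \<epsilon> scaleT T br pm scaleV V \<theta> by fact
  \<comment> \<open>A positive characteristic of a field is prime, and p > 3 excludes 2, so (p - 1)
    / 2 is the integer m below.\<close>
  have prime: "prime p"
    using prime_CHAR_semidom[where 'a = 'k] \<open>CHAR('k) = p\<close> \<open>p > 3\<close> by simp
  then have "odd p"
    using \<open>p > 3\<close> prime_odd_nat by simp
  then obtain m where m: "p = Suc (2 * m)" by (auto elim: oddE)
  show ?thesis
  proof (intro exI conjI ballI)
    show "restricted_lie_color_triple_system p \<epsilon> R.scaleL R.L R.brL R.pmL"
      by (rule R.restricted_semidirect[OF \<open>CHAR('k) = p\<close> prime m])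
  qed (simp add: R.pmL_def)
qed

end
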